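(* Let $\Phi$ be an algebraically closed field of characteristic $0$ and let $r\geq 3$ be an integer. There is no simple finite-dimensional $r$-ary Filippov superalgebra of type $A(1,0)$ over $\Phi$.
   Context: For an integer $r\ge 2$, an $r$-ary Filippov superalgebra over a field $k$ is a $\mathbb{Z}_2$-graded vector space $\mathcal F=\mathcal F_{\bar 0}\oplus\mathcal F_{\bar 1}$ over $k$ with an $r$-linear operation $[\cdot,\ldots,\cdot]$ that respects the grading (if $x_i\in\mathcal F_{\alpha_i}$ then $[x_1,\ldots,x_r]\in\mathcal F_{\alpha_1+\cdots+\alpha_r}$) and satisfies, for homogeneous elements with parities $p(\cdot)$: (1) $[x_1,\ldots,x_{i-1},x_i,\ldots,x_r]=-(-1)^{p(x_{i-1})p(x_i)}[x_1,\ldots,x_i,x_{i-1},\ldots,x_r]$; (2) $[y_2,\ldots,y_r,[x_1,\ldots,x_r]]=\sum_{i=1}^r(-1)^{p q_i}[x_1,\ldots,[y_2,\ldots,y_r,x_i],\ldots,x_r]$, where $p=\sum_{j=2}^r p(y_j)$ and $q_i=\sum_{j=1}^{i-1}p(x_j)$. An ideal of $\mathcal F$ is a $\mathbb Z_2$-graded subspace $I$ with $[I,\mathcal F,\ldots,\mathcal F]\subseteq I$. $\mathcal F$ is simple if $[\mathcal F,\ldots,\mathcal F]\ne 0$ and its only ideals are $0$ and $\mathcal F$. $Inder(\mathcal F)$ is the linear span in $End(\mathcal F)$ of the left multiplications $L(x_1,\ldots,x_{r-1}):y\mapsto[x_1,\ldots,x_{r-1},y]$; it is a Lie superalgebra under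 the supercommutator $[a,b]=ab-(-1)^{p(a)p(b)}ba$. For a Lie superalgebra $G$, $\mathcal F$ has type $G$ if $Inder(\mathcal F)\cong G$ as Lie superalgebras. $A(1,0):=sl(2,1)$ is the Lie superalgebra (under the supercommutator) of block matrices $\begin{pmatrix}A&B\\C&D\end{pmatrix}$ over $\Phi$ with $A$ of size $2\times2$, $D$ of size $1\times1$ and $\mathrm{tr}(A)=\mathrm{tr}(D)$; the even part is given by $B=0,C=0$ and the odd part by $A=0,D=0$. *)

theory Defs
  imports "HOL-Analysis.Analysis" "HOL-Library.Z2" "HOL-Library.Function_Algebras"
begin

section \<open>Signs and Filippov superalgebras\<close>

text \<open>Parities live in the ring \<^typ>\<open>bit\<close> of integers mod 2; \<open>sgn_act \<alpha> x\<close> is \<open>(-1)\<^sup>\<alpha> x\<close>.\<close>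

definition sgn_act :: "bit \<Rightarrow> 'a::ab_group_add \<Rightarrow> 'a" where
  "sgn_act \<alpha> x = (if \<alpha> = 0 then x else - x)"

text \<open>\<open>homog V \<alpha>s xs\<close>: the \<open>i\<close>-th entry of \<open>xs\<close> is homogeneous of parity \<open>\<alpha>s ! i\<close>
  (in particular both lists have the same length).\<close>

definition homog :: "(bit \<Rightarrow> 'v set) \<Rightarrow> bit list \<Rightarrow> 'v list \<Rightarrow> bool" where
  "homog V = list_all2 (\<lambda>\<alpha> x. x \<in> V \<alpha>)"

text \<open>The underlying space is the whole type \<open>'v\<close>. The \<open>r\<close>-ary operation \<open>br\<close> takes a list of
  arguments and only its values on lists of length \<open>r\<close> are meaningful.\<close>

locale filippov_superalgebra = vector_space smul
  for smul :: "'k::field \<Rightarrow> 'v::ab_group_add \<Rightarrow> 'v" (infixr \<open>\<cdot>\<close> 75) +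
  fixes r :: nat
    and V :: "bit \<Rightarrow> 'v set"
    and br :: "'v list \<Rightarrow> 'v"
  assumes arity: "2 \<le> r"
    and grading_subspace: "subspace (V \<alpha>)"
    and grading_inter: "V 0 \<inter> V 1 = {0}"
    and grading_sum: "\<exists>a\<in>V 0. \<exists>b\<in>V 1. x = a + b"
    and br_add: "length us + length ws + 1 = r \<Longrightarrow>
      br (us @ [x + y] @ ws) = br (us @ [x] @ ws) + br (us @ [y] @ ws)"
    and br_scale: "length us + length ws + 1 = r \<Longrightarrow>
      br (us @ [c \<cdot> x] @ ws) = c \<cdot> br (us @ [x] @ ws)"
    and br_grading: "length xs = r \<Longrightarrow> homog V \<alpha>s xs \<Longrightarrow> br xs \<in> V (sum_list \<alpha>s)"
    and br_anticomm: "length us + length ws + 2 = r \<Longrightarrow>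
      homog V \<alpha>s us \<Longrightarrow> homog V \<beta>s ws \<Longrightarrow> x \<in> V \<alpha> \<Longrightarrow> y \<in> V \<beta> \<Longrightarrow>
      br (us @ [x, y] @ ws) = - sgn_act (\<alpha> * \<beta>) (br (us @ [y, x] @ ws))"
    and br_jacobi: "length xs = r \<Longrightarrow> length ys = r - 1 \<Longrightarrow>
      homog V \<alpha>s xs \<Longrightarrow> homog V \<beta>s ys \<Longrightarrow>
      br (ys @ [br xs]) =
        (\<Sum>i<r. sgn_act (sum_list \<beta>s * sum_list (take i \<alpha>s)) (br (xs[i := br (ys @ [xs ! i])])))"
begin

definition is_ideal :: "'v set \<Rightarrow> bool" where
  "is_ideal I \<longleftrightarrow>
     subspace I \<and>
     (\<forall>x\<in>I. \<exists>a \<in> I \<inter> V 0. \<exists>b \<in> I \<inter> V 1. x = a + b) \<and>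
     (\<forall>x\<in>I. \<forall>ys. length ys = r - 1 \<longrightarrow> br (x # ys) \<in> I)"

definition is_simple :: bool where
  "is_simple \<longleftrightarrow>
     (\<exists>xs. length xs = r \<and> br xs \<noteq> 0) \<and>
     (\<forall>I. is_ideal I \<longrightarrow> I = {0} \<or> I = UNIV)"

end

section \<open>Lie superalgebras\<close>

text \<open>A superalgebra with one binary operation, carried by a graded subset of an ambient
  type. The record imposes no axioms: the two instances below are Lie superalgebras because they
  are graded subspaces of associative superalgebras that are closed under the supercommutator.\<close>

record ('k, 'a) lie_super =
  lcarrier :: "'a set"
  lpart :: "bit \<Rightarrow> 'a set"
  lscale :: "'k \<Rightarrow> 'a \<Rightarrow> 'a"
  lbracket :: "'a \<Rightarrow> 'a \<Rightarrow> 'a"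

definition lie_super_isomorphic ::
  "('k, 'a::plus) lie_super \<Rightarrow> ('k, 'b::plus) lie_super \<Rightarrow> bool" where
  "lie_super_isomorphic G H \<longleftrightarrow>
     (\<exists>\<phi>. bij_betw \<phi> (lcarrier G) (lcarrier H) \<and>
          (\<forall>x\<in>lcarrier G. \<forall>y\<in>lcarrier G. \<phi> (x + y) = \<phi> x + \<phi> y) \<and>
          (\<forall>c. \<forall>x\<in>lcarrier G. \<phi> (lscale G c x) = lscale H c (\<phi> x)) \<and>
          (\<forall>\<alpha>. \<phi> ` lpart G \<alpha> = lpart H \<alpha>) \<and>
          (\<forall>x\<in>lcarrier G. \<forall>y\<in>lcarrier G. \<phi> (lbracket G x y) = lbracket H (\<phi> x) (\<phi> y)))"

text \<open>The component of parity \<open>\<alpha>\<close> of an element of \<open>A 0 \<oplus> A 1\<close>.\<close>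

definition hpart :: "(bit \<Rightarrow> 'a::ab_group_add set) \<Rightarrow> bit \<Rightarrow> 'a \<Rightarrow> 'a" where
  "hpart A \<alpha> x = (THE y. y \<in> A \<alpha> \<and> x - y \<in> A (\<alpha> + 1))"

text \<open>The biadditive extension of \<open>[a,b] = ab - (-1)\<^bsup>p(a)p(b)\<^esup> ba\<close> from homogeneous to
  arbitrary elements of the associative superalgebra \<open>A 0 \<oplus> A 1\<close> with product \<open>mul\<close>.\<close>

definition supercomm ::
  "(bit \<Rightarrow> 'a::ab_group_add set) \<Rightarrow> ('a \<Rightarrow> 'a \<Rightarrow> 'a) \<Rightarrow> 'a \<Rightarrow> 'a \<Rightarrow> 'a" where
  "supercomm A mul a b =
     (\<Sum>\<alpha>\<in>{0, 1}. \<Sum>\<beta>\<in>{0, 1}.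
        mul (hpart A \<alpha> a) (hpart A \<beta> b) - sgn_act (\<alpha> * \<beta>) (mul (hpart A \<beta> b) (hpart A \<alpha> a)))"

lemma hpart_homogeneous:
  assumes inter: "A 0 \<inter> A 1 = {0}"
    and diff: "\<And>\<gamma> u v. u \<in> A \<gamma> \<Longrightarrow> v \<in> A \<gamma> \<Longrightarrow> u - v \<in> A \<gamma>"
    and x: "x \<in> A \<beta>"
  shows "hpart A \<alpha> x = (if \<alpha> = \<beta> then x else 0)"
proof -
  have inter': "u = 0" if "u \<in> A \<gamma>" "u \<in> A (\<gamma> + 1)" for u \<gamma>
    using that inter by (cases \<gamma>) auto
  have zero: "0 \<in> A \<gamma>" for \<gamma>
    using inter by (cases \<gamma>) auto
  let ?w = "if \<alpha> = \<beta> then x else 0"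
  have "\<beta> = \<alpha> + 1" if "\<alpha> \<noteq> \<beta>"
    using that by (cases \<alpha>; cases \<beta>) auto
  then have w: "?w \<in> A \<alpha> \<and> x - ?w \<in> A (\<alpha> + 1)"
    using x zero by auto
  show ?thesis
    unfolding hpart_def
  proof (rule the_equality)
    show "?w \<in> A \<alpha> \<and> x - ?w \<in> A (\<alpha> + 1)" by (rule w)
  next
    fix y assume y: "y \<in> A \<alpha> \<and> x - y \<in> A (\<alpha> + 1)"
    have "y - ?w \<in> A \<alpha>" using diff y w by blast
    moreover have "(x - ?w) - (x - y) \<in> A (\<alpha> + 1)" using diff y w by blast
    then have "y - ?w \<in> A (\<alpha> + 1)" by (simp add: algebra_simps)
    ultimately show "y = ?w" using inter' by fastforce
  qed
qed

lemma supercomm_homogeneous: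
  assumes inter: "A 0 \<inter> A 1 = {0}"
    and diff: "\<And>\<gamma> u v. u \<in> A \<gamma> \<Longrightarrow> v \<in> A \<gamma> \<Longrightarrow> u - v \<in> A \<gamma>"
    and mul0: "\<And>u. mul 0 u = 0" "\<And>u. u \<in> A 0 \<union> A 1 \<Longrightarrow> mul u 0 = 0"
    and a: "a \<in> A \<alpha>" and b: "b \<in> A \<beta>"
  shows "supercomm A mul a b = mul a b - sgn_act (\<alpha> * \<beta>) (mul b a)"
proof -
  have ha: "hpart A \<gamma> a = (if \<gamma> = \<alpha> then a else 0)" for \<gamma>
    by (rule hpart_homogeneous[of A]) (use inter diff a in auto)
  have hb: "hpart A \<gamma> b = (if \<gamma> = \<beta> then b else 0)" for \<gamma>
    by (rule hpart_homogeneous[of A]) (use inter diff b in auto)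
  have "a \<in> A 0 \<union> A 1" "b \<in> A 0 \<union> A 1"
    using a b by (cases \<alpha>; cases \<beta>; auto)+
  then have "mul a 0 = 0" "mul b 0 = 0"
    using mul0 by blast+
  then show ?thesis
    unfolding supercomm_def ha hb
    by (cases \<alpha>; cases \<beta>) (simp_all add: mul0(1) sgn_act_def)
qed

subsection \<open>Inner derivations\<close>

definition end_part ::
  "('k::field \<Rightarrow> 'v::ab_group_add \<Rightarrow> 'v) \<Rightarrow> (bit \<Rightarrow> 'v set) \<Rightarrow> bit \<Rightarrow> ('v \<Rightarrow> 'v) set" where
  "end_part smul V \<alpha> = {f. Vector_Spaces.linear smul smul f \<and> (\<forall>\<beta>. f ` V \<beta> \<subseteq> V (\<alpha> + \<beta>))}"

definition end_scale :: "('k \<Rightarrow> 'v \<Rightarrow> 'v) \<Rightarrow> 'k \<Rightarrow> ('v \<Rightarrow> 'v) \<Rightarrow> ('v \<Rightarrow> 'v)" where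
  "end_scale smul c f = (\<lambda>x. smul c (f x))"

lemma vector_space_end_scale:
  assumes "vector_space smul"
  shows "vector_space (end_scale smul)"
proof -
  interpret vector_space smul by fact
  show ?thesis
    by unfold_locales
      (auto simp: end_scale_def plus_fun_def scale_right_distrib scale_left_distrib)
qed

context filippov_superalgebra
begin

definition left_mult :: "'v list \<Rightarrow> 'v \<Rightarrow> 'v" where
  "left_mult xs = (\<lambda>y. br (xs @ [y]))"

definition Inder :: "('k, 'v \<Rightarrow> 'v) lie_super" where
  "Inder =
    (let D = module.span (end_scale smul) (left_mult ` {xs. length xs = r - 1})
     in \<lparr> lcarrier = D,
          lpart = (\<lambda>\<alpha>. D \<inter> end_part smul V \<alpha>),
          lscale = end_scale smul,
          lbracket = supercomm (end_part smul V) (\<circ>) \<rparr>)"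

definition has_type :: "('k, 'a::plus) lie_super \<Rightarrow> bool" where
  "has_type G \<longleftrightarrow> lie_super_isomorphic Inder G"

end

subsection \<open>Special linear Lie superalgebras\<close>

text \<open>Block matrices are square matrices indexed by a sum type: \<open>Inl\<close> indices for the first block
  and \<open>Inr\<close> indices for the second.\<close>

definition block_A :: "'k^('m::finite + 'n::finite)^('m + 'n) \<Rightarrow> 'k^'m^'m" where
  "block_A M = (\<chi> i j. M $ Inl i $ Inl j)"

definition block_B :: "'k^('m::finite + 'n::finite)^('m + 'n) \<Rightarrow> 'k^'n^'m" where
  "block_B M = (\<chi> i j. M $ Inl i $ Inr j)"

definition block_C :: "'k^('m::finite + 'n::finite)^('m + 'n) \<Rightarrow> 'k^'m^'n" where
  "block_C M = (\<chi> i j. M $ Inr i $ Inl j)"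

definition block_D :: "'k^('m::finite + 'n::finite)^('m + 'n) \<Rightarrow> 'k^'n^'n" where
  "block_D M = (\<chi> i j. M $ Inr i $ Inr j)"

definition gl_part :: "bit \<Rightarrow> ('k::field^('m::finite + 'n::finite)^('m + 'n)) set" where
  "gl_part \<alpha> = (if \<alpha> = 0 then {M. block_B M = 0 \<and> block_C M = 0}
                else {M. block_A M = 0 \<and> block_D M = 0})"

definition sl :: "('k::field, 'k^('m::finite + 'n::finite)^('m + 'n)) lie_super" where
  "sl =
    (let S = {M. trace (block_A M) = trace (block_D M)}
     in \<lparr> lcarrier = S,
          lpart = (\<lambda>\<alpha>. S \<inter> gl_part \<alpha>),
          lscale = (\<lambda>c M. \<chi> i j. c * M $ i $ j),
          lbracket = supercomm gl_part (**) \<rparr>)"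

definition A_1_0 :: "('k::field, 'k^(2 + 1)^(2 + 1)) lie_super" where
  "A_1_0 = sl"

end

theory Submission
  imports Defs
begin

text \<open>
  Suppose that \<open>F\<close> is such an algebra and write \<open>L(u)\<close> for left multiplications. By simplicity
  \<open>F\<close> is an irreducible \<open>sl(2,1)\<close>-module, graded by the eigenvalues (charges) of
  \<open>z = diag(1,1,2)\<close>, which has charges \<open>-1, 0, 1\<close> on \<open>sl(2,1)\<close> itself. Skew symmetry gives
  \<open>L(u) w = \<plusminus> L(u') x\<close> where \<open>u'\<close> is \<open>u\<close> with its entry \<open>x\<close> replaced by \<open>w\<close>. Take \<open>u\<close> of
  charge-homogeneous vectors with \<open>L(u) = s + \<zeta> z\<close>, \<open>s \<in> sl(2)\<close>, \<open>\<zeta> \<noteq> 0\<close>. Then \<open>L(u)\<close> does not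
  vanish on any component of nonzero charge, so the charges of those components are within 1 of
  the charge of every entry of \<open>u\<close>. Together with the Kac determinant \<open>\<nu>\<^sub>1 (1 - \<nu>\<^sub>2)\<close> of a highest
  weight vector this forces the charges of \<open>F\<close> to be \<open>1, 0, -1\<close> and all entries of \<open>u\<close> to have
  charge 0.

  Let \<open>T\<close> be the component of charge 1. Computing the trace of \<open>D \<mapsto> [D, L(u)]\<close> on the odd part of
  charge 1 of \<open>sl(2,1)\<close> directly, and via the derivation property, skew symmetry and the cyclicity
  of the trace, gives \<open>-2 \<zeta> = \<plusminus> (r - 1) \<zeta> dim T\<close>, with the sign \<open>+\<close> if \<open>T\<close> is even and \<open>-\<close> if \<open>T\<close>
  is odd. Hence \<open>r = 3\<close>, \<open>T\<close> is odd and one-dimensional, and \<open>F\<close> is four-dimensional. In that case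
  \<open>e\<close> commutes with every \<open>L(u)\<close> of charge 0, which contradicts \<open>[h, e] = 2 e\<close>.
\<close>

section \<open>Eigenvectors and traces of linear operators\<close>

text \<open>Horner evaluation of \<open>p(A) v\<close>; fixing the vector \<open>v\<close> avoids
  forming polynomials in an algebra of endomorphisms.\<close>

definition poly_op ::
  "('a::field \<Rightarrow> 'b::ab_group_add \<Rightarrow> 'b) \<Rightarrow> ('b \<Rightarrow> 'b) \<Rightarrow> 'a poly \<Rightarrow> 'b \<Rightarrow> 'b" where
  "poly_op s A p v = fold_coeffs (\<lambda>c w. s c v + A w) p 0"

text \<open>For a basis \<open>B\<close> of an \<open>A\<close>-invariant subspace this is the trace
  of the restriction of \<open>A\<close>, although \<open>A\<close> is defined on the whole
  space.\<close>

definition trace_on :: "('a::field \<Rightarrow> 'b::ab_group_add \<Rightarrow> 'b) \<Rightarrow> 'b set \<Rightarrow> ('b \<Rightarrow> 'b) \<Rightarrow> 'a" where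
  "trace_on s B A = (\<Sum>b\<in>B. module.representation s B (A b) b)"

section \<open>Independence of eigenvectors and polynomials in an operator\<close>

context vector_space begin

text \<open>Induction on the set of eigenvalues: applying \<open>A - c\<close> removes the summand
  for \<open>c\<close> and multiplies the others by \<open>y - c \<noteq> 0\<close>. Indexing the
  summands by their eigenvalues makes the eigenvalues distinct.\<close>

lemma eigenvectors_sum_zero:
  assumes A: "Vector_Spaces.linear scale scale A"
    and "finite S" and "\<And>y. y \<in> S \<Longrightarrow> A (w y) = scale y (w y)"
    and "(\<Sum>y\<in>S. w y) = 0" and "y \<in> S"
  shows "w y = 0"
  using assms(2-)
proof (induction S arbitrary: w y rule: finite_induct)
  case empty
  then show ?case by simp
next
  case (insert c S)
  interpret A: Vector_Spaces.linear scale scale A by fact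
  have "0 = A (\<Sum>y\<in>insert c S. w y) - scale c (\<Sum>y\<in>insert c S. w y)"
    by (simp only: insert.prems A.zero scale_zero_right diff_self)
  also have "\<dots> = (\<Sum>y\<in>insert c S. A (w y) - scale c (w y))"
    by (simp only: A.sum scale_sum_right sum_subtractf)
  also have "\<dots> = (\<Sum>y\<in>insert c S. scale (y - c) (w y))"
    using insert.prems(1) by (intro sum.cong refl) (metis scale_left_diff_distrib)
  also have "\<dots> = (\<Sum>y\<in>S. scale (y - c) (w y))"
    using insert.hyps by simp
  finally have s: "(\<Sum>y\<in>S. scale (y - c) (w y)) = 0" ..
  have z: "w y = 0" if "y \<in> S" for y
  proof -
    have "scale (y - c) (w y) = 0"
      by (rule insert.IH[OF _ s that]) (use insert.prems(1) in \<open>simp add: A.scale mult.commute\<close>)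
    then show ?thesis using that insert.hyps by auto
  qed
  then have "w c = 0"
    using insert.prems(2) insert.hyps by simp
  then show ?case using z insert.prems(3) by auto
qed

context
  fixes A assumes A: "Vector_Spaces.linear scale scale A"
begin

interpretation A: Vector_Spaces.linear scale scale A by (fact A)

lemma poly_op_0 [simp]: "poly_op scale A 0 v = 0"
  by (simp add: poly_op_def)

lemma poly_op_pCons [simp]: "poly_op scale A (pCons c p) v = scale c v + A (poly_op scale A p v)"
  by (cases "p = 0 \<and> c = 0") (auto simp: poly_op_def A.zero)

lemma poly_op_add: "poly_op scale A (p + q) v = poly_op scale A p v + poly_op scale A q v"
  by (induction p q rule: poly_induct2) (simp_all add: A.add algebra_simps)

lemma poly_op_smult: "poly_op scale A (smult c p) v = scale c (poly_op scale A p v)"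
  by (induction p) (simp_all add: A.scale A.add scale_right_distrib)

lemma poly_op_monom: "poly_op scale A (monom c n) v = scale c ((A ^^ n) v)"
  by (induction n) (simp_all add: monom_0 monom_Suc A.zero A.scale)

lemma poly_op_sum: "poly_op scale A (\<Sum>i\<in>I. p i) v = (\<Sum>i\<in>I. poly_op scale A (p i) v)"
  by (induction I rule: infinite_finite_induct) (simp_all add: poly_op_add)

lemma poly_op_linear_factor:
  "poly_op scale A ([:- c, 1:] * q) v = A (poly_op scale A q v) - scale c (poly_op scale A q v)"
proof -
  have *: "[:- c, 1:] * q = smult (- c) q + pCons 0 q"
    by simp
  show ?thesis
    unfolding * poly_op_add poly_op_smult poly_op_pCons by simp
qed

lemma poly_op_in_subspace:
  assumes "subspace S" "A ` S \<subseteq> S" "v \<in> S"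
  shows "poly_op scale A p v \<in> S"
proof (induction p)
  case 0
  then show ?case using assms by (simp add: subspace_0)
next
  case (pCons a p)
  then show ?case using assms
    by (auto intro!: subspace_add subspace_scale)
qed

end
end

text \<open>Split a factor \<open>X - c\<close> off \<open>p\<close>. Either the cofactor
  \<open>q\<close> already annihilates \<open>v\<close> and has smaller degree, or
  \<open>q(A) v\<close> is a nonzero vector killed by \<open>A - c\<close>.\<close>

lemma (in vector_space) poly_op_eigenvector:
  assumes A: "Vector_Spaces.linear scale scale A"
    and S: "subspace S" "A ` S \<subseteq> S" and v: "v \<in> S" "v \<noteq> 0"
    and lin: "\<And>q::'a poly. degree q > 0 \<Longrightarrow> \<exists>x. poly q x = 0"
    and p: "p \<noteq> 0" "poly_op scale A p v = 0"
  shows "\<exists>c w. w \<in> S \<and> w \<noteq> 0 \<and> A w = scale c w"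
  using p
proof (induction "degree p" arbitrary: p rule: less_induct)
  case less
  interpret A: Vector_Spaces.linear scale scale A by fact
  have "degree p > 0"
  proof (rule ccontr)
    assume "\<not> degree p > 0"
    then obtain c where "p = [:c:]" by (metis degree_eq_zeroE neq0_conv)
    with less.prems v show False
      using poly_op_pCons[OF A, of c 0 v] by (simp add: poly_op_0[OF A] A.zero)
  qed
  then obtain c where "poly p c = 0" using lin[of p] by auto
  then obtain q where q: "p = [:- c, 1:] * q"
    by (meson dvdE poly_eq_0_iff_dvd)
  with less.prems have "q \<noteq> 0" by auto
  then have "degree q < degree p"
    unfolding q by (subst degree_mult_eq) auto
  show ?case
  proof (cases "poly_op scale A q v = 0")
    case True
    then show ?thesis using less.hyps \<open>degree q < degree p\<close> \<open>q \<noteq> 0\<close> by blast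
  next
    case False
    have "A (poly_op scale A q v) = scale c (poly_op scale A q v)"
      using less.prems poly_op_linear_factor[OF A, of c q v] q by simp
    then show ?thesis using False poly_op_in_subspace[OF A S v(1)] by blast
  qed
qed

section \<open>Existence of eigenvectors in finite dimension\<close>

context finite_dimensional_vector_space begin

text \<open>The vectors \<open>A^n v\<close> either repeat, which gives \<open>X^i - X^j\<close>, or
  form an infinite and hence dependent set, whose linear relation is read as a polynomial.\<close>

lemma ex_annihilating_poly:
  assumes A: "Vector_Spaces.linear scale scale A"
  shows "\<exists>p. p \<noteq> 0 \<and> poly_op scale A p v = 0"
proof (cases "inj (\<lambda>n. (A ^^ n) v)")
  case False
  then obtain i j where ij: "i \<noteq> j" "(A ^^ i) v = (A ^^ j) v"
    by (auto simp: inj_def)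
  let ?p = "monom 1 i + smult (-1) (monom 1 j) :: 'a poly"
  have "poly_op scale A ?p v = 0"
    using ij by (simp only: poly_op_add[OF A] poly_op_smult[OF A] poly_op_monom[OF A]) simp
  moreover have "?p \<noteq> 0"
  proof
    assume "?p = 0"
    then have "coeff ?p i = 0" by (metis coeff_0)
    then show False using ij by simp
  qed
  ultimately show ?thesis by blast
next
  case True
  let ?w = "\<lambda>n. (A ^^ n) v"
  have "dependent (range ?w)"
    using True finiteI_independent range_inj_infinite by blast
  then obtain t u x where t: "finite t" "t \<subseteq> range ?w" "(\<Sum>v\<in>t. scale (u v) v) = 0"
    "x \<in> t" "u x \<noteq> 0"
    unfolding dependent_explicit by blast
  obtain N where N: "finite N" "t = ?w ` N"
    using t(1,2) finite_subset_image by metis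
  have injN: "inj_on ?w N" using True by (meson inj_on_subset subset_UNIV)
  let ?p = "\<Sum>n\<in>N. monom (u (?w n)) n"
  have "poly_op scale A ?p v = (\<Sum>n\<in>N. scale (u (?w n)) (?w n))"
    by (simp add: poly_op_sum[OF A] poly_op_monom[OF A])
  also have "\<dots> = 0"
    using t(3) unfolding N(2) sum.reindex[OF injN] by simp
  finally have "poly_op scale A ?p v = 0" .
  moreover obtain n where n: "n \<in> N" "x = ?w n" using t(4) N by auto
  have "coeff ?p n = u x"
    using n N by (simp add: coeff_sum)
  then have "?p \<noteq> 0" using t(5) by auto
  ultimately show ?thesis by blast
qed

text \<open>Eigenvectors for distinct eigenvalues are independent, so infinitely many of them
  contradict finite dimension.\<close>

lemma eigenvalues_not_infinite:
  assumes A: "Vector_Spaces.linear scale scale A"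
    and inj: "inj l" and w: "\<And>n::nat. w n \<noteq> 0" "\<And>n. A (w n) = scale (l n) (w n)"
  shows False
proof -
  have injw: "inj w"
  proof (rule injI)
    fix i j assume "w i = w j"
    then have "scale (l i) (w i) = scale (l j) (w i)"
      by (metis w(2))
    then have "l i = l j" using w(1) by (simp add: scale_cancel_right)
    then show "i = j" by (rule injD[OF inj])
  qed
  have "independent (range w)"
  proof
    assume "dependent (range w)"
    then obtain t u x where t: "finite t" "t \<subseteq> range w" "(\<Sum>v\<in>t. scale (u v) v) = 0"
      "x \<in> t" "u x \<noteq> 0"
      unfolding dependent_explicit by blast
    obtain N where N: "finite N" "t = w ` N"
      using t(1,2) finite_subset_image by metis
    have injN: "inj_on w N" and injl: "inj_on l N" using injw inj by (meson inj_on_subset subset_UNIV)+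
    \<comment> \<open>\<open>eigenvectors_sum_zero\<close> indexes its summands by eigenvalues, so
      the index \<open>n\<close> is recovered as \<open>inv l y\<close>.\<close>
    let ?W = "\<lambda>y. scale (u (w (inv l y))) (w (inv l y))"
    interpret A: Vector_Spaces.linear scale scale A by fact
    have s: "(\<Sum>y\<in>l ` N. ?W y) = 0"
      using t(3) inj by (simp add: N(2) sum.reindex[OF injN] sum.reindex[OF injl])
    obtain n where n: "n \<in> N" "x = w n" using t(4) N by auto
    have "?W (l n) = 0"
      by (rule eigenvectors_sum_zero[OF A _ _ s])
        (use N n inj in \<open>auto simp: A.scale w(2) mult.commute\<close>)
    then show False using t(5) n w(1) inj by simp
  qed
  then show False using finiteI_independent injw range_inj_infinite by blast
qed

end

text \<open>Otherwise every eigenvalue \<open>l\<close> on \<open>S\<close> entails the eigenvalue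
  \<open>l + c\<close>, and in characteristic 0 the values \<open>l + n c\<close> are infinitely
  many. It serves for \<open>z\<close> with \<open>c = 1\<close> and for \<open>h\<close> with
  \<open>c = 2\<close>.\<close>

lemma ex_top_eigenvector:
  fixes smul :: "'a::{alg_closed_field,field_char_0} \<Rightarrow> 'b::ab_group_add \<Rightarrow> 'b"
  assumes "finite_dimensional_vector_space smul Bs"
    and A: "Vector_Spaces.linear smul smul A"
    and S: "module.subspace smul S" "A ` S \<subseteq> S" and v: "v \<in> S" "v \<noteq> 0" and c: "c \<noteq> 0"
  shows "\<exists>l w. w \<in> S \<and> w \<noteq> 0 \<and> A w = smul l w \<and> (\<forall>w\<in>S. A w = smul (l + c) w \<longrightarrow> w = 0)"
proof (rule ccontr)
  assume neg: "\<not> ?thesis"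
  interpret finite_dimensional_vector_space smul Bs by fact
  have root: "\<exists>x. poly q x = 0" if "degree q > 0" for q :: "'a poly"
    using alg_closed_imp_poly_has_root[of q] that by simp
  obtain p where p: "p \<noteq> 0" "poly_op smul A p v = 0"
    using ex_annihilating_poly[OF A] by auto
  obtain l w where lw: "w \<in> S" "w \<noteq> 0" "A w = smul l w"
    using poly_op_eigenvector[OF A S v root p] by auto
  have "\<exists>w. w \<in> S \<and> w \<noteq> 0 \<and> A w = smul (l + of_nat n * c) w" for n
  proof (induction n)
    case 0
    then show ?case using lw by auto
  next
    case (Suc n)
    then obtain w where "w \<in> S" "w \<noteq> 0" "A w = smul ((l + of_nat n * c) + c) w"
      using neg by auto
    moreover have "l + of_nat n * c + c = l + of_nat (Suc n) * c"
      by (simp add: algebra_simps)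
    ultimately show ?case by auto
  qed
  then have "\<forall>n. \<exists>w. w \<in> S \<and> w \<noteq> 0 \<and> A w = smul (l + of_nat n * c) w" by simp
  from choice[OF this] obtain w
    where w: "\<forall>n. w n \<in> S \<and> w n \<noteq> 0 \<and> A (w n) = smul (l + of_nat n * c) (w n)"
    by auto
  have "inj (\<lambda>n::nat. l + of_nat n * c)"
    using c by (auto intro: injI)
  from eigenvalues_not_infinite[OF A this, of w] w show False by simp
qed

section \<open>Traces on invariant subspaces\<close>

context vector_space begin

context
  fixes B assumes B: "finite B" "independent B"
begin

lemma trace_on_add:
  "(\<And>b. b \<in> B \<Longrightarrow> A b \<in> span B) \<Longrightarrow> (\<And>b. b \<in> B \<Longrightarrow> A' b \<in> span B) \<Longrightarrow>
    trace_on scale B (\<lambda>x. A x + A' x) = trace_on scale B A + trace_on scale B A'"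
  using B by (simp add: trace_on_def representation_add sum.distrib)

lemma trace_on_scale:
  "(\<And>b. b \<in> B \<Longrightarrow> A b \<in> span B) \<Longrightarrow> trace_on scale B (\<lambda>x. scale c (A x)) = c * trace_on scale B A"
  using B by (simp add: trace_on_def representation_scale sum_distrib_left)

lemma trace_on_id: "trace_on scale B (\<lambda>x. x) = of_nat (card B)"
  using B by (simp add: trace_on_def representation_basis)

lemma trace_on_cong: "(\<And>b. b \<in> B \<Longrightarrow> A b = A' b) \<Longrightarrow> trace_on scale B A = trace_on scale B A'"
  by (simp add: trace_on_def)

lemma sum_representation: "v \<in> span B \<Longrightarrow> (\<Sum>b\<in>B. scale (representation B v b) b) = v"
  using B by (intro sum_representation_eq) auto

text \<open>Both traces are the same double sum of products of matrix entries, up to the order of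
  summation.\<close>

lemma trace_on_comp_commute:
  assumes A: "Vector_Spaces.linear scale scale A" "\<And>b. b \<in> B \<Longrightarrow> A b \<in> span B"
    and A': "Vector_Spaces.linear scale scale A'" "\<And>b. b \<in> B \<Longrightarrow> A' b \<in> span B"
  shows "trace_on scale B (\<lambda>x. A (A' x)) = trace_on scale B (\<lambda>x. A' (A x))"
proof -
  have *: "trace_on scale B (\<lambda>x. C (C' x)) =
      (\<Sum>b\<in>B. \<Sum>c\<in>B. representation B (C' b) c * representation B (C c) b)"
    if C: "Vector_Spaces.linear scale scale C" "\<And>b. b \<in> B \<Longrightarrow> C b \<in> span B"
      and C': "\<And>b. b \<in> B \<Longrightarrow> C' b \<in> span B" for C C'
    unfolding trace_on_def
  proof (rule sum.cong[OF refl])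
    fix b assume b: "b \<in> B"
    interpret C: Vector_Spaces.linear scale scale C by fact
    have "C (C' b) = C (\<Sum>c\<in>B. scale (representation B (C' b) c) c)"
      by (subst sum_representation) (use C' b in auto)
    also have "\<dots> = (\<Sum>c\<in>B. scale (representation B (C' b) c) (C c))"
      by (simp add: C.sum C.scale)
    finally show "representation B (C (C' b)) b =
        (\<Sum>c\<in>B. representation B (C' b) c * representation B (C c) b)"
      using B C by (simp add: representation_sum representation_scale span_scale)
  qed
  show ?thesis
    using sum.swap[of "\<lambda>b c. representation B (A' b) c * representation B (A c) b" B B]
    by (simp add: *[OF A A'(2)] *[OF A' A(2)] mult.commute)
qed

text \<open>The diagonal entries are \<open>l b\<close> times the coordinates of \<open>w\<close>;
  by linearity they add up to \<open>l w\<close>.\<close>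

lemma trace_on_rank_one:
  assumes "\<And>x y. l (x + y) = l x + l y" "\<And>c x. l (scale c x) = c * l x" "w \<in> span B"
  shows "trace_on scale B (\<lambda>t. scale (l t) w) = l w"
proof -
  have l0: "l 0 = 0" using assms(2)[of 0 0] by simp
  have lsum: "l (\<Sum>b\<in>C. g b) = (\<Sum>b\<in>C. l (g b))" if "finite C" for C and g :: "'b \<Rightarrow> 'b"
    using that by (induction C rule: finite_induct) (simp_all add: l0 assms)
  have "trace_on scale B (\<lambda>t. scale (l t) w) = (\<Sum>b\<in>B. l (scale (representation B w b) b))"
    using B assms by (simp add: trace_on_def representation_scale mult.commute)
  also have "\<dots> = l (\<Sum>b\<in>B. scale (representation B w b) b)"
    using B by (simp add: lsum)
  finally show ?thesis using assms by (simp add: sum_representation)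
qed

end
end

section \<open>Inner derivations of a Filippov superalgebra\<close>

lemma sgn_act_0 [simp]: "sgn_act 0 x = x"
  and sgn_act_1 [simp]: "sgn_act 1 x = - x"
  by (simp_all add: sgn_act_def)

lemma sgn_act_zero [simp]: "sgn_act \<alpha> 0 = 0"
  by (simp add: sgn_act_def)

lemma sgn_act_add: "sgn_act \<alpha> (x + y) = sgn_act \<alpha> x + sgn_act \<alpha> y"
  by (simp add: sgn_act_def)

lemma sgn_act_sgn_act: "sgn_act \<alpha> (sgn_act \<beta> x) = sgn_act (\<alpha> + \<beta>) x"
  by (cases \<alpha>; cases \<beta>) (simp_all add: sgn_act_def)

lemma sgn_act_eq_0_iff [simp]: "sgn_act \<alpha> x = 0 \<longleftrightarrow> x = 0"
  by (simp add: sgn_act_def)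

lemma sgn_act_fun: "sgn_act \<alpha> f x = sgn_act \<alpha> (f x)"
  by (simp add: sgn_act_def)

lemma sum_apply: "(\<Sum>i\<in>A. f i) x = (\<Sum>i\<in>A. f i x)"
  by (induction A rule: infinite_finite_induct) simp_all

lemma (in vector_space) scale_sgn_act: "scale c (sgn_act \<alpha> x) = sgn_act \<alpha> (scale c x)"
  by (simp add: sgn_act_def)

lemma (in vector_space) subspace_sgn_act: "subspace W \<Longrightarrow> x \<in> W \<Longrightarrow> sgn_act \<alpha> x \<in> W"
  by (simp add: sgn_act_def subspace_neg)

lemma homog_length: "homog V \<alpha>s xs \<Longrightarrow> length xs = length \<alpha>s"
  by (auto simp: homog_def dest: list_all2_lengthD)

lemma homog_Nil [simp]: "homog V [] []"
  and homog_Cons [simp]: "homog V (\<alpha> # \<alpha>s) (x # xs) \<longleftrightarrow> x \<in> V \<alpha> \<and> homog V \<alpha>s xs"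
  by (simp_all add: homog_def)

lemma homog_append: "homog V \<alpha>s xs \<Longrightarrow> homog V \<beta>s ys \<Longrightarrow> homog V (\<alpha>s @ \<beta>s) (xs @ ys)"
  by (simp add: homog_def list_all2_appendI)

lemma homog_update: "homog V \<alpha>s xs \<Longrightarrow> x \<in> V \<alpha> \<Longrightarrow> homog V (\<alpha>s[i := \<alpha>]) (xs[i := x])"
  by (simp add: homog_def list_all2_update_cong)

lemma homog_nth: "homog V \<alpha>s xs \<Longrightarrow> i < length xs \<Longrightarrow> xs ! i \<in> V (\<alpha>s ! i)"
  by (auto simp: homog_def list_all2_conv_all_nth)

lemma homog_take: "homog V \<alpha>s xs \<Longrightarrow> homog V (take i \<alpha>s) (take i xs)"
  and homog_drop: "homog V \<alpha>s xs \<Longrightarrow> homog V (drop i \<alpha>s) (drop i xs)"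
  by (simp_all add: homog_def)

lemma homog_exists:
  assumes "\<And>x. x \<in> set xs \<Longrightarrow> \<exists>\<alpha>. x \<in> V \<alpha>"
  shows "\<exists>\<alpha>s. homog V \<alpha>s xs"
  using assms
proof (induction xs)
  case Nil
  then show ?case using homog_Nil by blast
next
  case (Cons x xs)
  then show ?case by (metis homog_Cons list.set_intros)
qed

lemma sum_list_update_add:
  fixes xs :: "'a::comm_monoid_add list"
  shows "i < length xs \<Longrightarrow> sum_list (xs[i := y + xs ! i]) = y + sum_list xs"
  by (induction xs arbitrary: i) (auto split: nat.split simp: ac_simps)

text \<open>Entries are released from \<open>S\<close> one at a time: once the entries before it are
  in \<open>S\<close> and those after it are fixed, the admissible values of an entry form a
  subspace containing \<open>S\<close>.\<close>

lemma (in vector_space) span_lists_induct: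
  assumes subspace: "\<And>us ws. length us + length ws + 1 = n \<Longrightarrow> subspace {y. Q (us @ [y] @ ws)}"
    and span: "span S = UNIV"
    and base: "\<And>ys. set ys \<subseteq> S \<Longrightarrow> length ys = n \<Longrightarrow> Q ys"
    and "length ys = n"
  shows "Q ys"
proof -
  have "Q (us @ ys)" if "set us \<subseteq> S" "length us + length ys = n" for us ys
    using that
  proof (induction ys arbitrary: us)
    case Nil
    then show ?case using base by simp
  next
    case (Cons y ys)
    have "y \<in> span S" using span by simp
    moreover have "subspace {y. Q (us @ [y] @ ys)}"
      using subspace Cons.prems by simp
    moreover have "S \<subseteq> {y. Q (us @ [y] @ ys)}"
      using Cons.IH[of "us @ [y]" for y] Cons.prems by auto
    ultimately have "y \<in> {y. Q (us @ [y] @ ys)}"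
      using span_minimal by blast
    then show ?case by simp
  qed
  from this[of "[]" ys] assms(4) show ?thesis by simp
qed

section \<open>Multilinearity and skew symmetry of the bracket\<close>

context filippov_superalgebra
begin

lemma span_homogeneous: "span (V 0 \<union> V 1) = UNIV"
proof -
  have "x \<in> span (V 0 \<union> V 1)" for x
    using grading_sum[of x] span_add[OF span_base span_base] by blast
  then show ?thesis by blast
qed

lemma grading_disjoint: "x \<in> V \<alpha> \<Longrightarrow> x \<in> V (\<alpha> + 1) \<Longrightarrow> x = 0"
  using grading_inter by (cases \<alpha>) auto

lemma br_zero: "length us + length ws + 1 = r \<Longrightarrow> br (us @ [0] @ ws) = 0"
  using br_scale[of us ws 0 0] by simp

lemma br_subspace:
  assumes "length us + length ws + 1 = r" "subspace W"
  shows "subspace {y. br (us @ [y] @ ws) \<in> W}"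
proof (rule subspaceI)
  show "0 \<in> {y. br (us @ [y] @ ws) \<in> W}"
    unfolding mem_Collect_eq br_zero[OF assms(1)] by (rule subspace_0[OF assms(2)])
  show "x + y \<in> {y. br (us @ [y] @ ws) \<in> W}"
    if "x \<in> {y. br (us @ [y] @ ws) \<in> W}" "y \<in> {y. br (us @ [y] @ ws) \<in> W}" for x y
    using that unfolding mem_Collect_eq br_add[OF assms(1)] by (rule subspace_add[OF assms(2)])
  show "c \<cdot> x \<in> {y. br (us @ [y] @ ws) \<in> W}"
    if "x \<in> {y. br (us @ [y] @ ws) \<in> W}" for c x
    using that unfolding mem_Collect_eq br_scale[OF assms(1)] by (rule subspace_scale[OF assms(2)])
qed

text \<open>A transposition with an entry of parity \<beta> contributes
  \<open>1 + \<alpha> * \<beta>\<close> to the exponent of the sign; the induction adds up these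
  contributions modulo 2.\<close>

lemma br_move_right:
  assumes "length us + length ws + length vs + 1 = r"
    and "homog V \<gamma>s us" "x \<in> V \<alpha>" "homog V \<beta>s ws" "homog V \<delta>s vs"
  shows "br (us @ [x] @ ws @ vs) =
    sgn_act (of_nat (length ws) + \<alpha> * sum_list \<beta>s) (br (us @ ws @ [x] @ vs))"
  using assms
proof (induction ws arbitrary: us \<gamma>s \<beta>s)
  case Nil
  then show ?case using homog_length[OF Nil(4)] by simp
next
  case (Cons w ws)
  from Cons.prems(4) obtain \<beta> \<beta>s' where b: "\<beta>s = \<beta> # \<beta>s'"
    using homog_length by (metis length_Suc_conv)
  with Cons.prems(4) have w: "w \<in> V \<beta>" "homog V \<beta>s' ws" by simp_all
  have "br (us @ [x] @ (w # ws) @ vs) = br (us @ [x, w] @ (ws @ vs))" by simp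
  also have "\<dots> = - sgn_act (\<alpha> * \<beta>) (br (us @ [w, x] @ (ws @ vs)))"
    using Cons.prems w
    by (intro br_anticomm[where \<alpha>s = \<gamma>s and \<beta>s = "\<beta>s' @ \<delta>s"]) (auto intro: homog_append)
  also have "br (us @ [w, x] @ (ws @ vs)) = br ((us @ [w]) @ [x] @ ws @ vs)" by simp
  also have "\<dots> = sgn_act (of_nat (length ws) + \<alpha> * sum_list \<beta>s') (br ((us @ [w]) @ ws @ [x] @ vs))"
    using Cons.prems w homog_append[OF Cons.prems(2), of "[\<beta>]" "[w]"]
    by (intro Cons.IH) auto
  finally have "br (us @ [x] @ (w # ws) @ vs) =
    sgn_act 1 (sgn_act (\<alpha> * \<beta>) (sgn_act (of_nat (length ws) + \<alpha> * sum_list \<beta>s')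
      (br (us @ (w # ws) @ [x] @ vs))))"
    by simp
  also have "\<dots> = sgn_act (of_nat (length (w # ws)) + \<alpha> * sum_list \<beta>s)
      (br (us @ (w # ws) @ [x] @ vs))"
  proof -
    have "1 + (\<alpha> * \<beta> + (n + \<alpha> * s)) = 1 + n + \<alpha> * (\<beta> + s)" for n s :: bit
      by (cases n; cases \<alpha>; cases \<beta>; cases s; simp)
    moreover have "of_nat (length (w # ws)) = (1 + of_nat (length ws) :: bit)"
      by simp
    ultimately show ?thesis by (simp only: sgn_act_sgn_act b sum_list.Cons)
  qed
  finally show ?case .
qed

text \<open>Both sides are compared with the list in which \<open>x\<close> and \<open>w\<close>
  stand together at the end. The two moves across \<open>ws\<close> contribute
  \<open>length ws\<close> each, which cancels modulo 2, and one transposition remains.\<close>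

lemma br_swap_last:
  assumes "length us + length ws + 2 = r"
    and "homog V \<gamma>s us" "x \<in> V \<alpha>" "homog V \<beta>s ws" "w \<in> V \<delta>"
  shows "br (us @ [x] @ ws @ [w]) =
    sgn_act (1 + \<alpha> * \<delta> + (\<alpha> + \<delta>) * sum_list \<beta>s) (br (us @ [w] @ ws @ [x]))"
proof -
  have 1: "br (us @ [x] @ ws @ [w]) =
      sgn_act (of_nat (length ws) + \<alpha> * sum_list \<beta>s) (br (us @ ws @ [x] @ [w]))"
    using assms by (intro br_move_right[where \<gamma>s = \<gamma>s and \<delta>s = "[\<delta>]"]) auto
  have 2: "br (us @ [w] @ ws @ [x]) =
      sgn_act (of_nat (length ws) + \<delta> * sum_list \<beta>s) (br (us @ ws @ [w] @ [x]))"
    using assms by (intro br_move_right[where \<gamma>s = \<gamma>s and \<delta>s = "[\<alpha>]"]) auto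
  have 3: "br ((us @ ws) @ [x, w] @ []) = - sgn_act (\<alpha> * \<delta>) (br ((us @ ws) @ [w, x] @ []))"
    using assms by (intro br_anticomm[where \<alpha>s = "\<gamma>s @ \<beta>s" and \<beta>s = "[]"]) (auto intro: homog_append)
  have 4: "br (us @ ws @ [w, x]) =
      sgn_act (of_nat (length ws) + \<delta> * sum_list \<beta>s) (br (us @ [w] @ ws @ [x]))"
    unfolding 2 by (simp add: sgn_act_sgn_act)
  have 5: "n + \<alpha> * s + (1 + (\<alpha> * \<delta> + (n + \<delta> * s))) = 1 + \<alpha> * \<delta> + (\<alpha> + \<delta>) * s" for n s :: bit
    by (cases n; cases \<alpha>; cases \<delta>; cases s; simp)
  have "br (us @ [x] @ ws @ [w]) = sgn_act (of_nat (length ws) + \<alpha> * sum_list \<beta>s)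
      (sgn_act 1 (sgn_act (\<alpha> * \<delta>)
        (sgn_act (of_nat (length ws) + \<delta> * sum_list \<beta>s) (br (us @ [w] @ ws @ [x])))))"
    unfolding 1 4[symmetric] using 3 by simp
  then show ?thesis by (simp only: sgn_act_sgn_act 5)
qed

lemma br_update_add:
  assumes "length xs = r" "i < r"
  shows "br (xs[i := x + y]) = br (xs[i := x]) + br (xs[i := y])"
  using br_add[of "take i xs" "drop (Suc i) xs" x y] assms
  by (simp add: upd_conv_take_nth_drop)

lemma br_update_scale:
  assumes "length xs = r" "i < r"
  shows "br (xs[i := c \<cdot> x]) = c \<cdot> br (xs[i := x])"
  using br_scale[of "take i xs" "drop (Suc i) xs" c x] assms
  by (simp add: upd_conv_take_nth_drop)

section \<open>Inner derivations and their parity\<close>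

abbreviation inder :: "('v \<Rightarrow> 'v) set" where
  "inder \<equiv> module.span (end_scale smul) (left_mult ` {xs. length xs = r - 1})"

interpretation op: vector_space "end_scale smul"
  by (rule vector_space_end_scale) (rule vector_space_axioms)

lemma left_mult_linear:
  assumes "length u = r - 1"
  shows "Vector_Spaces.linear smul smul (left_mult u)"
proof (unfold_locales)
  have l: "length u + length [] + 1 = r" using assms arity by simp
  show "left_mult u (x + y) = left_mult u x + left_mult u y" for x y
    using br_add[OF l] by (simp add: left_mult_def)
  show "left_mult u (c \<cdot> x) = c \<cdot> left_mult u x" for c x
    using br_scale[OF l] by (simp add: left_mult_def)
qed

lemma op_subspace_linear: "op.subspace {f. Vector_Spaces.linear smul smul f}"
proof -
  have "Vector_Spaces.linear smul smul 0"
    by unfold_locales simp_all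
  moreover have "Vector_Spaces.linear smul smul (f + g)"
    if "Vector_Spaces.linear smul smul f" "Vector_Spaces.linear smul smul g" for f g
  proof -
    interpret f: Vector_Spaces.linear smul smul f by fact
    interpret g: Vector_Spaces.linear smul smul g by fact
    show ?thesis
      by unfold_locales (simp_all add: f.add g.add f.scale g.scale scale_right_distrib)
  qed
  moreover have "Vector_Spaces.linear smul smul (end_scale smul c f)"
    if "Vector_Spaces.linear smul smul f" for c f
  proof -
    interpret f: Vector_Spaces.linear smul smul f by fact
    show ?thesis
      by unfold_locales (simp_all add: end_scale_def f.add f.scale scale_right_distrib mult.commute)
  qed
  ultimately show ?thesis by (simp add: op.subspace_def)
qed

lemma inder_linear: "D \<in> inder \<Longrightarrow> Vector_Spaces.linear smul smul D"
proof -
  assume D: "D \<in> inder"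
  have "inder \<subseteq> {f. Vector_Spaces.linear smul smul f}"
    by (rule op.span_minimal[OF _ op_subspace_linear]) (use left_mult_linear in blast)
  then show ?thesis using D by blast
qed

lemma op_subspace_end_part: "op.subspace (end_part smul V \<alpha>)"
proof -
  have "op.subspace {f. \<forall>\<beta>. f ` V \<beta> \<subseteq> V (\<alpha> + \<beta>)}"
    unfolding op.subspace_def mem_Collect_eq image_subset_iff plus_fun_apply zero_fun_apply end_scale_def
    by (intro conjI allI ballI impI)
      (blast intro: subspace_0[OF grading_subspace] subspace_add[OF grading_subspace]
        subspace_scale[OF grading_subspace])+
  from op.subspace_inter[OF op_subspace_linear this] show ?thesis
    unfolding end_part_def by (simp only: Collect_conj_eq)
qed

lemma left_mult_end_part:
  assumes "length u = r - 1" "homog V \<alpha>s u"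
  shows "left_mult u \<in> end_part smul V (sum_list \<alpha>s)"
proof -
  have "br (u @ [x]) \<in> V (sum_list \<alpha>s + \<beta>)" if "x \<in> V \<beta>" for x \<beta>
    using br_grading[of "u @ [x]" "\<alpha>s @ [\<beta>]"] assms arity that by (simp add: homog_append)
  then show ?thesis
    using left_mult_linear[OF assms(1)] unfolding end_part_def left_mult_def by blast
qed

lemma end_part_inter: 
  assumes "f \<in> end_part smul V \<alpha>" "f \<in> end_part smul V (\<alpha> + 1)"
  shows "f = 0"
proof
  fix x
  interpret f: Vector_Spaces.linear smul smul f
    using assms by (simp add: end_part_def)
  have *: "f y = 0" if "y \<in> V \<gamma>" for y \<gamma>
  proof (rule grading_disjoint[of "f y" "\<alpha> + \<gamma>"])
    show "f y \<in> V (\<alpha> + \<gamma>)" using assms(1) that unfolding end_part_def by blast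
    have "f y \<in> V (\<alpha> + 1 + \<gamma>)" using assms(2) that unfolding end_part_def by blast
    then show "f y \<in> V (\<alpha> + \<gamma> + 1)" by (simp only: ac_simps)
  qed
  obtain a b where "a \<in> V 0" "b \<in> V 1" "x = a + b" using grading_sum by blast
  then show "f x = 0 x" using * by (simp add: f.add)
qed

text \<open>Generated by left multiplications with homogeneous entries, so that identities can be
  checked on these generators; \<open>inder_part_eq\<close> identifies it with the graded part of
  \<open>Inder\<close>.\<close>

definition inder_part :: "bit \<Rightarrow> ('v \<Rightarrow> 'v) set" where
  "inder_part \<beta> = op.span {left_mult u |u \<alpha>s. length u = r - 1 \<and> homog V \<alpha>s u \<and> sum_list \<alpha>s = \<beta>}"

lemma inder_part_subset: "inder_part \<beta> \<subseteq> inder \<inter> end_part smul V \<beta>"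
  unfolding inder_part_def
  by (intro Int_greatest op.span_mono op.span_minimal op_subspace_end_part)
    (auto simp: left_mult_end_part)

lemma left_mult_update_add:
  assumes "length us + length ws + 2 = r"
  shows "left_mult (us @ [x + y] @ ws) = left_mult (us @ [x] @ ws) + left_mult (us @ [y] @ ws)"
    "left_mult (us @ [c \<cdot> x] @ ws) = end_scale smul c (left_mult (us @ [x] @ ws))"
proof -
  have l: "length us + length (ws @ [z]) + 1 = r" for z
    using assms by simp
  show "left_mult (us @ [x + y] @ ws) = left_mult (us @ [x] @ ws) + left_mult (us @ [y] @ ws)"
    using br_add[OF l] by (simp add: left_mult_def fun_eq_iff)
  show "left_mult (us @ [c \<cdot> x] @ ws) = end_scale smul c (left_mult (us @ [x] @ ws))"
    using br_scale[OF l] by (simp add: left_mult_def fun_eq_iff end_scale_def)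
qed

lemma left_mult_subspace:
  assumes "length us + length ws + 2 = r" "op.subspace W"
  shows "subspace {y. left_mult (us @ [y] @ ws) \<in> W}"
proof -
  have "left_mult (us @ [0] @ ws) = 0"
    using left_mult_update_add(2)[OF assms(1), of 0 0] by (simp add: end_scale_def fun_eq_iff)
  then show ?thesis
    using assms(2) left_mult_update_add[OF assms(1)] by (auto simp: subspace_def op.subspace_def)
qed

text \<open>Left multiplication is linear in every entry, so \<open>span_lists_induct\<close>
  reduces arbitrary lists to lists over \<open>S\<close>.\<close>

lemma inder_subset:
  assumes W: "op.subspace W" and S: "span S = UNIV"
    and base: "\<And>u. length u = r - 1 \<Longrightarrow> set u \<subseteq> S \<Longrightarrow> left_mult u \<in> W"
  shows "inder \<subseteq> W"
proof (rule op.span_minimal[OF _ W], clarify)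
  fix u :: "'v list" assume "length u = r - 1"
  then show "left_mult u \<in> W"
    by (rule span_lists_induct[where Q = "\<lambda>u. left_mult u \<in> W" and S = S, rotated -1])
      (use left_mult_subspace[OF _ W] S base in auto)
qed

text \<open>Homogeneous lists generate, so \<open>D\<close> splits as \<open>a + b\<close> with
  \<open>a\<close> of parity \<beta> and \<open>b\<close> of the other parity. Then
  \<open>b = D - a\<close> has both parities and vanishes.\<close>

lemma inder_part_eq: "inder_part \<beta> = inder \<inter> end_part smul V \<beta>"
proof
  show "inder \<inter> end_part smul V \<beta> \<subseteq> inder_part \<beta>"
  proof
    fix D assume D: "D \<in> inder \<inter> end_part smul V \<beta>"
    let ?W = "{a + b |a b. a \<in> inder_part \<beta> \<and> b \<in> inder_part (\<beta> + 1)}"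
    have sub: "op.subspace (inder_part \<gamma>)" for \<gamma>
      by (simp add: inder_part_def)
    have "inder \<subseteq> ?W"
    proof (rule inder_subset)
      show "op.subspace ?W" by (rule op.subspace_sums) (rule sub)+
      show "span (V 0 \<union> V 1) = UNIV" by (rule span_homogeneous)
      fix u assume u: "length u = r - 1" "set u \<subseteq> V 0 \<union> V 1"
      then obtain \<alpha>s where a: "homog V \<alpha>s u" using homog_exists[of u V] by blast
      then have "left_mult u \<in> inder_part (sum_list \<alpha>s)"
        using u by (auto simp: inder_part_def intro: op.span_base)
      moreover have "sum_list \<alpha>s = \<beta> \<or> sum_list \<alpha>s = \<beta> + 1"
        by (cases \<beta>; cases "sum_list \<alpha>s") auto
      ultimately show "left_mult u \<in> ?W"
        using op.subspace_0[OF sub] by (metis (mono_tags, lifting) add.right_neutral add.left_neutral mem_Collect_eq)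
    qed
    then obtain a b where ab: "D = a + b" "a \<in> inder_part \<beta>" "b \<in> inder_part (\<beta> + 1)"
      using D by blast
    have "b = D - a" using ab by simp
    then have "b \<in> end_part smul V \<beta>"
      using D ab inder_part_subset op.subspace_diff[OF op_subspace_end_part] by blast
    then have "b = 0" using end_part_inter ab inder_part_subset by blast
    then show "D \<in> inder_part \<beta>" using ab by simp
  qed
qed (rule inder_part_subset)

text \<open>On the generators this is the Jacobi identity, and the condition is linear in
  \<open>D\<close>.\<close>

lemma inder_part_derivation:
  assumes D: "D \<in> inder_part \<alpha>" and xs: "length xs = r" "homog V \<alpha>s xs"
  shows "D (br xs) = (\<Sum>i<r. sgn_act (\<alpha> * sum_list (take i \<alpha>s)) (br (xs[i := D (xs ! i)])))"
proof -
  let ?W = "{D. D (br xs) = (\<Sum>i<r. sgn_act (\<alpha> * sum_list (take i \<alpha>s)) (br (xs[i := D (xs ! i)])))}"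
  have "br (xs[i := 0]) = 0" if "i < r" for i
    using br_update_scale[OF xs(1) that, of 0 0] by simp
  then have "op.subspace ?W"
    using xs
    by (auto simp: op.subspace_def end_scale_def br_update_add br_update_scale sgn_act_add
        sum.distrib scale_sum_right scale_sgn_act)
  moreover have "left_mult u \<in> ?W"
    if "length u = r - 1" "homog V \<beta>s u" "sum_list \<beta>s = \<alpha>" for u \<beta>s
    using br_jacobi[OF xs(1) that(1) xs(2) that(2)] that by (simp add: left_mult_def)
  ultimately have "inder_part \<alpha> \<subseteq> ?W"
    unfolding inder_part_def by (intro op.span_minimal) auto
  then show ?thesis using D by blast
qed

lemma linear_eq_on_homogeneous:
  assumes "Vector_Spaces.linear smul smul f" "Vector_Spaces.linear smul smul g"
    and "\<And>\<gamma> w. w \<in> V \<gamma> \<Longrightarrow> f w = g w"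
  shows "f w = g w"
proof -
  interpret f: Vector_Spaces.linear smul smul f by fact
  interpret g: Vector_Spaces.linear smul smul g by fact
  obtain a b where "a \<in> V 0" "b \<in> V 1" "w = a + b" using grading_sum by blast
  then show ?thesis using assms(3) by (simp add: f.add g.add)
qed

text \<open>Apply the derivation \<open>D\<close> to the bracket of \<open>u @ [w]\<close>; the
  summand for the last entry is the second product of the commutator. Homogeneous \<open>w\<close>
  suffice because both sides are linear in \<open>w\<close>.\<close>

lemma commutator_left_mult:
  assumes D: "D \<in> inder_part \<alpha>" and u: "length u = r - 1" "homog V \<alpha>s u"
  shows "D (left_mult u w) - sgn_act (\<alpha> * sum_list \<alpha>s) (left_mult u (D w)) =
    (\<Sum>i<r - 1. sgn_act (\<alpha> * sum_list (take i \<alpha>s)) (left_mult (u[i := D (u ! i)]) w))"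
proof -
  have l: "length \<alpha>s = r - 1" "length u = r - 1" "Suc (r - 1) = r"
    using u arity homog_length[OF u(2)] by auto
  have lD: "Vector_Spaces.linear smul smul D"
    using D inder_part_subset inder_linear by blast
  interpret D: Vector_Spaces.linear smul smul D by fact
  interpret L: Vector_Spaces.linear smul smul "left_mult u" by (rule left_mult_linear) fact
  let ?f = "\<lambda>w. D (left_mult u w) - sgn_act (\<alpha> * sum_list \<alpha>s) (left_mult u (D w))"
  let ?g = "\<lambda>w. \<Sum>i<r - 1. sgn_act (\<alpha> * sum_list (take i \<alpha>s)) (left_mult (u[i := D (u ! i)]) w)"
  have lf: "Vector_Spaces.linear smul smul ?f"
    by unfold_locales (simp_all add: L.add L.scale D.add D.scale sgn_act_add scale_sgn_act algebra_simps)
  have lu: "Vector_Spaces.linear smul smul (left_mult (u[i := x]))" for i x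
    using left_mult_linear u by simp
  have add: "left_mult (u[i := x]) (a + b) = left_mult (u[i := x]) a + left_mult (u[i := x]) b"
    and scl: "left_mult (u[i := x]) (c \<cdot> a) = c \<cdot> left_mult (u[i := x]) a" for i x a b c
  proof -
    interpret M: Vector_Spaces.linear smul smul "left_mult (u[i := x])" by (rule lu)
    show "left_mult (u[i := x]) (a + b) = left_mult (u[i := x]) a + left_mult (u[i := x]) b"
      and "left_mult (u[i := x]) (c \<cdot> a) = c \<cdot> left_mult (u[i := x]) a"
      by (rule M.add M.scale)+
  qed
  have lg: "Vector_Spaces.linear smul smul ?g"
    by unfold_locales (simp_all add: add scl sgn_act_add scale_sgn_act sum.distrib scale_sum_right)
  have "?f w = ?g w" if "w \<in> V \<gamma>" for w \<gamma>
  proof -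
    have "D (br (u @ [w])) = (\<Sum>i<r. sgn_act (\<alpha> * sum_list (take i (\<alpha>s @ [\<gamma>])))
        (br ((u @ [w])[i := D ((u @ [w]) ! i)])))"
      using that u l by (intro inder_part_derivation[OF D]) (auto intro: homog_append)
    also have "{..<r} = insert (r - 1) {..<r - 1}"
      using l(3) lessThan_Suc by metis
    also have "(\<Sum>i\<in>\<dots>. sgn_act (\<alpha> * sum_list (take i (\<alpha>s @ [\<gamma>])))
        (br ((u @ [w])[i := D ((u @ [w]) ! i)]))) =
        sgn_act (\<alpha> * sum_list \<alpha>s) (br (u @ [D w])) +
        (\<Sum>i<r - 1. sgn_act (\<alpha> * sum_list (take i \<alpha>s)) (br (u[i := D (u ! i)] @ [w])))"
      using l by (simp add: nth_append list_update_append)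
    finally show ?thesis by (simp add: left_mult_def)
  qed
  then show ?thesis by (rule linear_eq_on_homogeneous[OF lf lg])
qed

text \<open>By \<open>commutator_left_mult\<close> the commutator with a generator is a sum of left
  multiplications in which \<open>D\<close> has acted on one entry, and these have total parity
  \<alpha> + \<beta>.\<close>

lemma inder_part_commutator:
  assumes D: "D \<in> inder_part \<alpha>" and D': "D' \<in> inder_part \<beta>"
  shows "(\<lambda>w. D (D' w) - sgn_act (\<alpha> * \<beta>) (D' (D w))) \<in> inder_part (\<alpha> + \<beta>)"
proof -
  have lD: "Vector_Spaces.linear smul smul D"
    using D inder_part_subset inder_linear by blast
  interpret D: Vector_Spaces.linear smul smul D by fact
  have sub: "op.subspace (inder_part \<gamma>)" for \<gamma>
    by (simp add: inder_part_def)
  let ?c = "\<lambda>D'. (\<lambda>w. D (D' w) - sgn_act (\<alpha> * \<beta>) (D' (D w)))"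
  let ?W = "{D'. ?c D' \<in> inder_part (\<alpha> + \<beta>)}"
  have c: "?c 0 = 0" "?c (f + g) = ?c f + ?c g" "?c (end_scale smul c f) = end_scale smul c (?c f)" for f g c
    by (auto simp: fun_eq_iff D.zero D.add D.scale end_scale_def sgn_act_add scale_sgn_act algebra_simps)
  have W: "op.subspace ?W"
    unfolding op.subspace_def mem_Collect_eq c
    by (intro conjI ballI allI op.subspace_0 op.subspace_add op.subspace_scale sub) simp_all
  have "left_mult u \<in> ?W"
    if u: "length u = r - 1" "homog V \<alpha>s u" "sum_list \<alpha>s = \<beta>" for u \<alpha>s
  proof -
    have "?c (left_mult u) =
      (\<Sum>i<r - 1. sgn_act (\<alpha> * sum_list (take i \<alpha>s)) (left_mult (u[i := D (u ! i)])))"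
      using commutator_left_mult[OF D u(1,2)] u(3) by (simp add: fun_eq_iff sum_apply sgn_act_fun)
    also have "\<dots> \<in> inder_part (\<alpha> + \<beta>)"
    proof (intro op.subspace_sum[OF sub] op.subspace_sgn_act[OF sub])
      fix i assume i: "i \<in> {..<r - 1}"
      have "D (u ! i) \<in> V (\<alpha> + \<alpha>s ! i)"
      proof -
        have "D ` V (\<alpha>s ! i) \<subseteq> V (\<alpha> + \<alpha>s ! i)"
          using subsetD[OF inder_part_subset D] unfolding end_part_def by blast
        moreover have "u ! i \<in> V (\<alpha>s ! i)"
          using i u(1) by (intro homog_nth[OF u(2)]) simp
        ultimately show ?thesis by blast
      qed
      then have "homog V (\<alpha>s[i := \<alpha> + \<alpha>s ! i]) (u[i := D (u ! i)])"
        by (rule homog_update[OF u(2)])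
      moreover have "sum_list (\<alpha>s[i := \<alpha> + \<alpha>s ! i]) = \<alpha> + \<beta>"
        using sum_list_update_add[of i \<alpha>s \<alpha>] i u homog_length[OF u(2)] by simp
      ultimately show "left_mult (u[i := D (u ! i)]) \<in> inder_part (\<alpha> + \<beta>)"
        using u(1) length_list_update[of u i "D (u ! i)"] unfolding inder_part_def
        by (intro op.span_base CollectI exI conjI) (simp_all only:)
    qed
    finally show ?thesis by simp
  qed
  then have "inder_part \<beta> \<subseteq> ?W"
    unfolding inder_part_def[of \<beta>] by (intro op.span_minimal[OF _ W]) auto
  then show ?thesis using D' by blast
qed

text \<open>An ideal must absorb brackets with its element in the first place. Skew symmetry moves a
  homogeneous element to the last place, where the bracket is an inner derivation.\<close>

lemma is_ideal_if_inder_stable: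
  assumes I: "subspace I" and graded: "\<And>x. x \<in> I \<Longrightarrow> \<exists>a \<in> I \<inter> V 0. \<exists>b \<in> I \<inter> V 1. x = a + b"
    and stable: "\<And>D x. D \<in> inder \<Longrightarrow> x \<in> I \<Longrightarrow> D x \<in> I"
  shows "is_ideal I"
proof -
  have homogeneous: "br (x # ys) \<in> I" if x: "x \<in> I \<inter> V \<alpha>" and ys: "length ys = r - 1" for x \<alpha> ys
    using ys
  proof (rule span_lists_induct[where Q = "\<lambda>ys. br (x # ys) \<in> I" and S = "V 0 \<union> V 1", rotated -1])
    fix us ws :: "'v list" assume "length us + length ws + 1 = r - 1"
    then show "subspace {y. br (x # us @ [y] @ ws) \<in> I}"
      using br_subspace[of "x # us" ws I] I by simp
  next
    fix ys assume ys: "set ys \<subseteq> V 0 \<union> V 1" "length ys = r - 1"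
    then obtain \<beta>s where b: "homog V \<beta>s ys" using homog_exists[of ys V] by blast
    have "br ([] @ [x] @ ys @ []) =
        sgn_act (of_nat (length ys) + \<alpha> * sum_list \<beta>s) (br ([] @ ys @ [x] @ []))"
    proof (rule br_move_right)
      show "length [] + length ys + length [] + 1 = r" using ys arity by simp
      show "x \<in> V \<alpha>" using x by blast
    qed (rule homog_Nil b)+
    moreover have "left_mult ys x \<in> I"
      by (rule stable[OF op.span_base]) (use x ys in blast)+
    ultimately show "br (x # ys) \<in> I"
      using I by (simp add: left_mult_def subspace_sgn_act)
  qed (rule span_homogeneous)
  have "br (x # ys) \<in> I" if x: "x \<in> I" and ys: "length ys = r - 1" for x ys
  proof -
    obtain a b where ab: "a \<in> I \<inter> V 0" "b \<in> I \<inter> V 1" "x = a + b"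
      using graded[OF x] by blast
    have "br (x # ys) = br (a # ys) + br (b # ys)"
      using br_add[of "[]" ys a b] ys arity ab by simp
    then show ?thesis
      using homogeneous[OF ab(1) ys] homogeneous[OF ab(2) ys] subspace_add[OF I] by metis
  qed
  then show ?thesis
    using I graded unfolding is_ideal_def by blast
qed

lemma supercomm_inder_part:
  assumes D: "D \<in> inder_part \<alpha>" and D': "D' \<in> inder_part \<beta>"
  shows "supercomm (end_part smul V) (\<circ>) D D' = (\<lambda>w. D (D' w) - sgn_act (\<alpha> * \<beta>) (D' (D w)))"
proof -
  have end_part: "D \<in> end_part smul V \<alpha>" "D' \<in> end_part smul V \<beta>"
    using D D' inder_part_subset by blast+
  have zero: "0 \<in> end_part smul V \<gamma>" for \<gamma>
    by (rule op.subspace_0[OF op_subspace_end_part])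
  have inter: "end_part smul V 0 \<inter> end_part smul V 1 = {0}"
    using end_part_inter[of _ 0] zero by (simp only: add_0_left) blast
  have "supercomm (end_part smul V) (\<circ>) D D' = (D \<circ> D') - sgn_act (\<alpha> * \<beta>) (D' \<circ> D)"
  proof (rule supercomm_homogeneous[where A = "end_part smul V" and mul = "(\<circ>)", OF inter])
    show "u - v \<in> end_part smul V \<gamma>"
      if "u \<in> end_part smul V \<gamma>" "v \<in> end_part smul V \<gamma>" for \<gamma> u v
      using that by (rule op.subspace_diff[OF op_subspace_end_part])
    show "D \<in> end_part smul V \<alpha>" "D' \<in> end_part smul V \<beta>" by (rule end_part)+
    show "0 \<circ> u = 0" for u :: "'b \<Rightarrow> 'b" by auto
    show "u \<circ> 0 = 0" if "u \<in> end_part smul V 0 \<union> end_part smul V 1" for u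
    proof -
      interpret u: Vector_Spaces.linear smul smul u
        using that by (auto simp: end_part_def)
      show ?thesis by (simp add: fun_eq_iff u.zero)
    qed
  qed
  then show ?thesis by (simp add: fun_eq_iff sgn_act_fun)
qed

lemma left_mult_update_linear:
  assumes "length u = r - 1" "i < r - 1"
  shows "left_mult (u[i := x + y]) w = left_mult (u[i := x]) w + left_mult (u[i := y]) w"
    "left_mult (u[i := c \<cdot> x]) w = c \<cdot> left_mult (u[i := x]) w"
proof -
  have l: "length (u @ [w]) = r" "i < r" using assms arity by auto
  show "left_mult (u[i := x + y]) w = left_mult (u[i := x]) w + left_mult (u[i := y]) w"
    "left_mult (u[i := c \<cdot> x]) w = c \<cdot> left_mult (u[i := x]) w"
    using br_update_add[OF l, of x y] br_update_scale[OF l, of c x] assms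
    by (simp_all add: left_mult_def list_update_append1)
qed

text \<open>The exchange of the operand \<open>w\<close> with an entry of \<open>u\<close>.
  Comparing the charges on both sides restricts the rows of the entries, and the same exchange
  yields the trace formula.\<close>

lemma left_mult_swap:
  assumes u: "length u = r - 1" "homog V \<alpha>s u" and i: "i < r - 1" and w: "w \<in> V \<delta>"
  shows "left_mult u w =
    sgn_act (1 + \<alpha>s ! i * \<delta> + (\<alpha>s ! i + \<delta>) * sum_list (drop (Suc i) \<alpha>s)) (left_mult (u[i := w]) (u ! i))"
proof -
  have "br (take i u @ [u ! i] @ drop (Suc i) u @ [w]) =
    sgn_act (1 + \<alpha>s ! i * \<delta> + (\<alpha>s ! i + \<delta>) * sum_list (drop (Suc i) \<alpha>s))
      (br (take i u @ [w] @ drop (Suc i) u @ [u ! i]))"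
  proof (rule br_swap_last)
    show "length (take i u) + length (drop (Suc i) u) + 2 = r" using u(1) i arity by simp
    show "homog V (take i \<alpha>s) (take i u)" "homog V (drop (Suc i) \<alpha>s) (drop (Suc i) u)"
      using u(2) by (rule homog_take homog_drop)+
    show "u ! i \<in> V (\<alpha>s ! i)" using u i by (intro homog_nth) simp_all
  qed (rule w)
  moreover have "take i u @ [u ! i] @ drop (Suc i) u = u"
    using i u(1) id_take_nth_drop[of i u] by simp
  moreover have "take i u @ [w] @ drop (Suc i) u = u[i := w]"
    using i u(1) by (simp add: upd_conv_take_nth_drop)
  ultimately show ?thesis
    unfolding left_mult_def by (metis append.assoc)
qed

lemma left_mult_update_zero:
  "length u = r - 1 \<Longrightarrow> i < r - 1 \<Longrightarrow> left_mult (u[i := 0]) w = 0"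
  using left_mult_update_linear(2)[of u i 0 0 w] by simp

end

section \<open>The action of sl(2,1)\<close>

text \<open>The operators \<open>e, f, h, z\<close> and \<open>a1, a2, b1, b2\<close> satisfy the relations of the matrices
  \<open>E\<^sub>1\<^sub>2, E\<^sub>2\<^sub>1, E\<^sub>1\<^sub>1 - E\<^sub>2\<^sub>2, diag(1,1,2)\<close> and \<open>E\<^sub>3\<^sub>1, E\<^sub>3\<^sub>2, E\<^sub>1\<^sub>3, E\<^sub>2\<^sub>3\<close>. The relations are oriented
  as rewrite rules towards the order \<open>b, a, f, e, h, z\<close>.\<close>

locale filippov_A_1_0 =
  filippov_superalgebra smul r V br + finite_dimensional_vector_space smul Bs
  for smul :: "'k::{alg_closed_field,field_char_0} \<Rightarrow> 'v::ab_group_add \<Rightarrow> 'v" (infixr \<open>\<cdot>\<close> 75)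
    and r V br Bs +
  fixes e f h z a1 a2 b1 b2 :: "'v \<Rightarrow> 'v"
  assumes arity_ge_3: "3 \<le> r"
    and simple: "is_simple"
    and even_ops: "e \<in> inder_part 0" "f \<in> inder_part 0" "h \<in> inder_part 0" "z \<in> inder_part 0"
    and odd_ops: "a1 \<in> inder_part 1" "a2 \<in> inder_part 1" "b1 \<in> inder_part 1" "b2 \<in> inder_part 1"
    and sl2_rels: "h (e x) = e (h x) + 2 \<cdot> e x" "h (f x) = f (h x) - 2 \<cdot> f x" "e (f x) = f (e x) + h x"
    and z_rels: "z (e x) = e (z x)" "z (f x) = f (z x)" "z (h x) = h (z x)"
      "z (a1 x) = a1 (z x) + a1 x" "z (a2 x) = a2 (z x) + a2 x"
      "z (b1 x) = b1 (z x) - b1 x" "z (b2 x) = b2 (z x) - b2 x"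
    and a_rels: "e (a1 x) = a1 (e x) - a2 x" "e (a2 x) = a2 (e x)"
      "f (a1 x) = a1 (f x)" "f (a2 x) = a2 (f x) - a1 x"
      "h (a1 x) = a1 (h x) - a1 x" "h (a2 x) = a2 (h x) + a2 x"
    and b_rels: "e (b1 x) = b1 (e x)" "e (b2 x) = b2 (e x) + b1 x"
      "f (b1 x) = b1 (f x) + b2 x" "f (b2 x) = b2 (f x)"
      "h (b1 x) = b1 (h x) + b1 x" "h (b2 x) = b2 (h x) - b2 x"
    and bb_rels: "b1 (b1 x) = 0" "b2 (b2 x) = 0" "b2 (b1 x) = - b1 (b2 x)"
    and ab_rels: "a1 (b1 x) = (1 / 2) \<cdot> (z x + h x) - b1 (a1 x)" "a1 (b2 x) = f x - b2 (a1 x)"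
      "a2 (b1 x) = e x - b1 (a2 x)" "a2 (b2 x) = (1 / 2) \<cdot> (z x - h x) - b2 (a2 x)"
    and spanning: "D \<in> inder \<Longrightarrow> \<exists>c :: nat \<Rightarrow> 'k. \<forall>x. D x =
      c 0 \<cdot> e x + c 1 \<cdot> f x + c 2 \<cdot> h x + c 3 \<cdot> z x + c 4 \<cdot> a1 x + c 5 \<cdot> a2 x + c 6 \<cdot> b1 x + c 7 \<cdot> b2 x"
    and indep: "\<And>(c :: nat \<Rightarrow> 'k) j. (\<And>x. c 0 \<cdot> e x + c 1 \<cdot> f x + c 2 \<cdot> h x + c 3 \<cdot> z x +
      c 4 \<cdot> a1 x + c 5 \<cdot> a2 x + c 6 \<cdot> b1 x + c 7 \<cdot> b2 x = 0) \<Longrightarrow> j < 8 \<Longrightarrow> c j = 0"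
begin

interpretation op: vector_space "end_scale smul"
  by (rule vector_space_end_scale) (rule vector_space_axioms)

lemma inder_part_in_inder: "D \<in> inder_part \<alpha> \<Longrightarrow> D \<in> inder"
  by (rule IntD1[OF subsetD[OF inder_part_subset]])

lemma inder_part_linear: "D \<in> inder_part \<alpha> \<Longrightarrow> Vector_Spaces.linear smul smul D"
  by (rule inder_linear[OF inder_part_in_inder])

lemma inder_part_maps:
  assumes "D \<in> inder_part \<alpha>" "x \<in> V \<beta>"
  shows "D x \<in> V (\<alpha> + \<beta>)"
proof -
  have "D ` V \<beta> \<subseteq> V (\<alpha> + \<beta>)"
    using IntD2[OF subsetD[OF inder_part_subset assms(1)]] unfolding end_part_def by simp
  then show ?thesis using assms(2) by blast
qed

sublocale e: Vector_Spaces.linear smul smul e by (rule inder_part_linear even_ops)+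
sublocale f: Vector_Spaces.linear smul smul f by (rule inder_part_linear even_ops)+
sublocale h: Vector_Spaces.linear smul smul h by (rule inder_part_linear even_ops)+
sublocale z: Vector_Spaces.linear smul smul z by (rule inder_part_linear even_ops)+
sublocale a1: Vector_Spaces.linear smul smul a1 by (rule inder_part_linear odd_ops)+
sublocale a2: Vector_Spaces.linear smul smul a2 by (rule inder_part_linear odd_ops)+
sublocale b1: Vector_Spaces.linear smul smul b1 by (rule inder_part_linear odd_ops)+
sublocale b2: Vector_Spaces.linear smul smul b2 by (rule inder_part_linear odd_ops)+

lemmas ops_linear =
  e.add f.add h.add z.add a1.add a2.add b1.add b2.add
  e.diff f.diff h.diff z.diff a1.diff a2.diff b1.diff b2.diff
  e.neg f.neg h.neg z.neg a1.neg a2.neg b1.neg b2.neg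
  e.scale f.scale h.scale z.scale a1.scale a2.scale b1.scale b2.scale
  e.zero f.zero h.zero z.zero a1.zero a2.zero b1.zero b2.zero

section \<open>Coordinates of inner derivations\<close>

text \<open>The order is \<open>e, f, h, z, a1, a2, b1, b2\<close>, so index 3 is the coefficient of
  \<open>z\<close>, written \<zeta> in the outline. Only the values of \<open>c\<close> below 8
  matter.\<close>

definition comb :: "(nat \<Rightarrow> 'k) \<Rightarrow> 'v \<Rightarrow> 'v" where
  "comb c x = c 0 \<cdot> e x + c 1 \<cdot> f x + c 2 \<cdot> h x + c 3 \<cdot> z x +
     c 4 \<cdot> a1 x + c 5 \<cdot> a2 x + c 6 \<cdot> b1 x + c 7 \<cdot> b2 x"

text \<open>On inner derivations, independence determines the values below 8; the others are
  arbitrary.\<close>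

definition coord :: "('v \<Rightarrow> 'v) \<Rightarrow> nat \<Rightarrow> 'k" where
  "coord D = (SOME c. \<forall>x. D x = comb c x)"

lemma comb_add: "comb (\<lambda>j. c j + d j) x = comb c x + comb d x"
  by (simp add: comb_def scale_left_distrib)

lemma comb_diff: "comb (\<lambda>j. c j - d j) x = comb c x - comb d x"
  by (simp add: comb_def scale_left_diff_distrib)

lemma comb_scale: "comb (\<lambda>j. y * c j) x = y \<cdot> comb c x"
  by (simp add: comb_def scale_right_distrib)

lemma comb_coord:
  assumes "D \<in> inder"
  shows "D x = comb (coord D) x"
proof -
  have "\<exists>c. \<forall>x. D x = comb c x"
    using spanning[OF assms] by (simp only: comb_def)
  then have "\<forall>x. D x = comb (coord D) x"
    unfolding coord_def by (rule someI_ex)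
  then show ?thesis ..
qed

lemma comb_indep:
  assumes "\<And>x. comb c x = 0" "j < 8"
  shows "c j = 0"
  by (rule indep[of c, OF _ assms(2)]) (rule assms(1)[unfolded comb_def])

lemma coord_eqI:
  assumes "\<And>x. D x = comb c x" "j < 8"
  shows "coord D j = c j"
proof -
  have "\<forall>x. D x = comb (coord D) x"
    unfolding coord_def by (rule someI[of _ c]) (rule allI, rule assms(1))
  then have "comb (\<lambda>j. coord D j - c j) x = 0" for x
    by (simp add: comb_diff assms(1))
  then have "coord D j - c j = 0"
    using assms(2) by (rule comb_indep)
  then show ?thesis by simp
qed

lemma coord_add:
  "D \<in> inder \<Longrightarrow> D' \<in> inder \<Longrightarrow> j < 8 \<Longrightarrow> coord (D + D') j = coord D j + coord D' j"
  by (rule coord_eqI) (simp_all only: comb_add comb_coord[symmetric] plus_fun_apply)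

lemma coord_scale:
  "D \<in> inder \<Longrightarrow> j < 8 \<Longrightarrow> coord (end_scale smul y D) j = y * coord D j"
  by (rule coord_eqI) (simp_all only: comb_scale comb_coord[symmetric] end_scale_def)

lemma coord_zero: "j < 8 \<Longrightarrow> coord 0 j = 0"
  using coord_eqI[of 0 "\<lambda>_. 0" j] by (simp add: comb_def)

lemma coord_subspace: "j < 8 \<Longrightarrow> op.subspace {D \<in> inder. coord D j = 0}"
  unfolding op.subspace_def
  by (simp add: coord_add coord_scale coord_zero op.span_zero op.span_add op.span_scale)

text \<open>The eigenvalue of the commutator with \<open>z\<close> on the generator of index
  \<open>j\<close>.\<close>

definition ad_weight :: "nat \<Rightarrow> 'k" where
  "ad_weight j = (if j < 4 then 0 else if j < 6 then 1 else - 1)"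

lemma z_comb: "z (comb c x) = comb c (z x) + comb (\<lambda>j. ad_weight j * c j) x"
  by (simp add: comb_def ad_weight_def z.add z.scale z_rels scale_right_distrib scale_right_diff_distrib)

text \<open>The commutator with \<open>z\<close> multiplies coordinate \<open>j\<close> by
  \<open>ad_weight j\<close>, so an eigenvector for \<open>y\<close> has nonzero coordinates only
  where \<open>ad_weight\<close> takes the value \<open>y\<close>.\<close>

lemma coord_ad_weight:
  assumes D: "D \<in> inder" and y: "\<And>x. z (D x) - D (z x) = y \<cdot> D x" and j: "j < 8" "coord D j \<noteq> 0"
  shows "y = ad_weight j"
proof -
  have "comb (\<lambda>j. ad_weight j * coord D j - y * coord D j) x = 0" for x
  proof -
    have "comb (\<lambda>j. ad_weight j * coord D j) x = z (D x) - D (z x)"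
      unfolding comb_coord[OF D, of x] comb_coord[OF D, of "z x"] z_comb by (rule add_diff_cancel_left'[symmetric])
    also have "\<dots> = y \<cdot> D x" by (rule y)
    also have "D x = comb (coord D) x" by (rule comb_coord[OF D])
    finally show ?thesis
      by (simp only: comb_diff comb_scale diff_self)
  qed
  then have "ad_weight j * coord D j - y * coord D j = 0"
    using j(1) by (rule comb_indep)
  then show ?thesis using j(2) by simp
qed

lemma ex_generator_coord: "j < 8 \<Longrightarrow> \<exists>D\<in>inder. coord D j \<noteq> 0"
proof -
  assume j: "j < 8"
  have *: "\<exists>D\<in>inder. coord D j \<noteq> 0"
    if "D \<in> inder" "\<And>x. D x = comb (\<lambda>i. if i = j then 1 else 0) x" for D
  proof
    show "coord D j \<noteq> 0"
      unfolding coord_eqI[OF that(2) j] by simp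
  qed (rule that(1))
  note in_inder = even_ops[THEN inder_part_in_inder] odd_ops[THEN inder_part_in_inder]
  from j consider "j = 0" | "j = 1" | "j = 2" | "j = 3" | "j = 4" | "j = 5" | "j = 6" | "j = 7"
    by linarith
  then show ?thesis
    by cases (rule *, rule in_inder, simp add: comb_def)+
qed

text \<open>Coordinate \<open>j\<close> is a linear functional that is nonzero on one of the eight
  generators, so it cannot vanish on all left multiplications with entries from a spanning
  set.\<close>

lemma ex_left_mult_coord:
  assumes S: "span S = UNIV" and j: "j < 8"
  shows "\<exists>u. length u = r - 1 \<and> set u \<subseteq> S \<and> coord (left_mult u) j \<noteq> 0"
proof (rule ccontr)
  assume neg: "\<not> ?thesis"
  have "inder \<subseteq> {D \<in> inder. coord D j = 0}"
  proof (rule inder_subset[OF coord_subspace[OF j] S])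
    fix u assume "length u = r - 1" "set u \<subseteq> S"
    then show "left_mult u \<in> {D \<in> inder. coord D j = 0}"
      using neg by (auto intro: op.span_base)
  qed
  then show False using ex_generator_coord[OF j] by blast
qed

text \<open>Irreducibility of the module: the span of homogeneous vectors is graded, and stability
  under the eight operators makes it an ideal, so simplicity applies.\<close>

lemma span_eq_UNIV:
  assumes hom: "\<And>x. x \<in> S \<Longrightarrow> \<exists>\<alpha>. x \<in> V \<alpha>" and nz: "x0 \<in> S" "x0 \<noteq> 0"
    and stable: "\<And>x. x \<in> S \<Longrightarrow> e x \<in> span S" "\<And>x. x \<in> S \<Longrightarrow> f x \<in> span S"
      "\<And>x. x \<in> S \<Longrightarrow> h x \<in> span S" "\<And>x. x \<in> S \<Longrightarrow> z x \<in> span S"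
      "\<And>x. x \<in> S \<Longrightarrow> a1 x \<in> span S" "\<And>x. x \<in> S \<Longrightarrow> a2 x \<in> span S"
      "\<And>x. x \<in> S \<Longrightarrow> b1 x \<in> span S" "\<And>x. x \<in> S \<Longrightarrow> b2 x \<in> span S"
  shows "span S = UNIV"
proof -
  have "is_ideal (span S)"
  proof (rule is_ideal_if_inder_stable)
    have sub: "subspace (span S \<inter> V \<alpha>)" for \<alpha>
      by (intro subspace_inter subspace_span grading_subspace)
    have "span S \<subseteq> {a + b |a b. a \<in> span S \<inter> V 0 \<and> b \<in> span S \<inter> V 1}"
    proof (rule span_minimal)
      show "S \<subseteq> {a + b |a b. a \<in> span S \<inter> V 0 \<and> b \<in> span S \<inter> V 1}"
      proof
        fix x assume x: "x \<in> S"
        then obtain \<alpha> where "x \<in> V \<alpha>" using hom by blast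
        then consider "x \<in> V 0" | "x \<in> V 1" by (cases \<alpha>) auto
        then show "x \<in> {a + b |a b. a \<in> span S \<inter> V 0 \<and> b \<in> span S \<inter> V 1}"
        proof cases
          case 1
          then have "x = x + 0 \<and> x \<in> span S \<inter> V 0 \<and> 0 \<in> span S \<inter> V 1"
            using x subspace_0[OF sub] by (simp add: span_base)
          then show ?thesis by blast
        next
          case 2
          then have "x = 0 + x \<and> 0 \<in> span S \<inter> V 0 \<and> x \<in> span S \<inter> V 1"
            using x subspace_0[OF sub] by (simp add: span_base)
          then show ?thesis by blast
        qed
      qed
    qed (rule subspace_sums sub)+
    then show "\<exists>a\<in>span S \<inter> V 0. \<exists>b\<in>span S \<inter> V 1. x = a + b" if "x \<in> span S" for x
      using that by blast
    fix D x assume D: "D \<in> inder" and x: "x \<in> span S"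
    interpret D: Vector_Spaces.linear smul smul D by (rule inder_linear[OF D])
    have "D y \<in> span S" if "y \<in> S" for y
    proof -
      have "comb (coord D) y \<in> span S"
        unfolding comb_def by (intro span_add span_scale stable that)
      then show ?thesis by (simp only: comb_coord[OF D, of y])
    qed
    then have "S \<subseteq> D -` span S" by (simp add: subset_iff)
    moreover have "subspace (D -` span S)"
      by (rule D.subspace_vimage) simp
    ultimately have "span S \<subseteq> D -` span S" by (rule span_minimal)
    then show "D x \<in> span S" using x by blast
  qed simp
  then have "span S = {0} \<or> span S = UNIV"
    using simple unfolding is_simple_def by blast
  then show ?thesis using span_base[OF nz(1)] nz(2) by blast
qed

text \<open>Since \<open>z\<close> is even, both homogeneous components of an eigenvector satisfy
  the eigenvalue equation, and one of them is nonzero.\<close>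

lemma ex_top_homogeneous:
  "\<exists>p \<pi> t. t \<in> V \<pi> \<and> t \<noteq> 0 \<and> z t = p \<cdot> t \<and> (\<forall>x. z x = (p + 1) \<cdot> x \<longrightarrow> x = 0)"
proof -
  obtain v :: 'v where "v \<noteq> 0" using simple unfolding is_simple_def by blast
  have "\<exists>p w. w \<in> UNIV \<and> w \<noteq> 0 \<and> z w = p \<cdot> w \<and> (\<forall>x\<in>UNIV. z x = (p + 1) \<cdot> x \<longrightarrow> x = 0)"
    by (rule ex_top_eigenvector[of smul Bs z UNIV v 1])
      (use \<open>v \<noteq> 0\<close> in \<open>simp_all add: finite_dimensional_vector_space_axioms z.linear_axioms\<close>)
  then obtain p w where pw: "w \<noteq> 0" "z w = p \<cdot> w" "\<forall>x. z x = (p + 1) \<cdot> x \<longrightarrow> x = 0"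
    by blast
  obtain w0 w1 where w: "w0 \<in> V 0" "w1 \<in> V 1" "w = w0 + w1" using grading_sum by blast
  have zV: "z x - p \<cdot> x \<in> V \<alpha>" if "x \<in> V \<alpha>" for x \<alpha>
    using inder_part_maps[OF even_ops(4) that] that
    by (intro subspace_diff[OF grading_subspace] subspace_scale[OF grading_subspace])
      (simp_all only: add_0_left)
  have eq: "z w0 - p \<cdot> w0 = - (z w1 - p \<cdot> w1)"
    using pw(2) unfolding w(3) by (simp add: z.add scale_right_distrib algebra_simps)
  have "z w0 - p \<cdot> w0 \<in> V 1"
    unfolding eq by (intro subspace_neg[OF grading_subspace] zV w)
  then have "z w0 - p \<cdot> w0 = 0"
    using grading_inter zV[OF w(1)] by blast
  moreover from this have "z w1 - p \<cdot> w1 = 0" using eq by simp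
  moreover have "w0 \<noteq> 0 \<or> w1 \<noteq> 0" using pw(1) w(3) by auto
  ultimately show ?thesis using w(1,2) pw(3) by fastforce
qed

end

section \<open>Decomposition into rows of equal charge\<close>

locale filippov_A_1_0_top = filippov_A_1_0 +
  fixes p :: 'a and \<pi> :: bit and t :: 'b
  assumes t: "t \<in> V \<pi>" "t \<noteq> 0" "z t = p \<cdot> t"
    and top: "\<And>x. z x = (p + 1) \<cdot> x \<Longrightarrow> x = 0"
begin

interpretation op: vector_space "end_scale smul"
  by (rule vector_space_end_scale) (rule vector_space_axioms)

text \<open>An element of \<open>sl(2,1)\<close> of \<open>z\<close>-charge \<open>c\<close> has parity \<open>c mod 2\<close>, so the vectors whose charge is
  \<open>p - n\<close> and whose parity is \<open>\<pi> + n\<close>, \<open>n = 0, 1, \<dots>\<close>, span a submodule.\<close>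

definition row :: "nat \<Rightarrow> 'b set" where
  "row n = {x \<in> V (\<pi> + of_nat n). z x = (p - of_nat n) \<cdot> x}"

lemma row_subspace: "subspace (row n)"
  unfolding row_def
  by (intro subspaceI CollectI conjI)
    (auto simp: z.add z.scale z.zero scale_right_distrib mult.commute
      intro: subspace_0[OF grading_subspace] subspace_add[OF grading_subspace]
        subspace_scale[OF grading_subspace])

lemma row_V: "x \<in> row n \<Longrightarrow> x \<in> V (\<pi> + of_nat n)"
  and row_z: "x \<in> row n \<Longrightarrow> z x = (p - of_nat n) \<cdot> x"
  by (simp_all add: row_def)

lemma t_row: "t \<in> row 0"
  unfolding row_def using t by (simp only: mem_Collect_eq of_nat_0 add_0_right diff_zero simp_thms)

lemma even_row:
  assumes "x \<in> row n"
  shows "e x \<in> row n" "f x \<in> row n" "h x \<in> row n" "z x \<in> row n"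
proof -
  note V = inder_part_maps[OF _ row_V[OF assms], of _ 0, unfolded add_0_left]
  show "e x \<in> row n" "f x \<in> row n" "h x \<in> row n" "z x \<in> row n"
    unfolding row_def
    by (rule CollectI, rule conjI, rule V, rule even_ops,
        simp only: z_rels row_z[OF assms] e.scale f.scale h.scale z.scale)+
qed

lemma b_row:
  assumes "x \<in> row n"
  shows "b1 x \<in> row (Suc n)" "b2 x \<in> row (Suc n)"
proof -
  have *: "1 + (\<pi> + of_nat n) = \<pi> + of_nat (Suc n)"
    by (simp only: of_nat_Suc ac_simps)
  note V = inder_part_maps[OF _ row_V[OF assms], of _ 1, unfolded *]
  show "b1 x \<in> row (Suc n)" "b2 x \<in> row (Suc n)"
    unfolding row_def
    by (rule CollectI, rule conjI, rule V, rule odd_ops,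
        simp only: z_rels row_z[OF assms] b1.scale b2.scale of_nat_Suc, simp add: algebra_simps)+
qed

text \<open>\<open>a1\<close> and \<open>a2\<close> raise the charge by 1, and \<open>p + 1\<close>
  is not an eigenvalue of \<open>z\<close>.\<close>

lemma a_row_0:
  assumes "x \<in> row 0"
  shows "a1 x = 0" "a2 x = 0"
  using row_z[OF assms] top[of "a1 x"] top[of "a2 x"]
  by (simp_all add: z_rels a1.scale a2.scale scale_left_distrib)

lemma a_row_Suc:
  assumes "x \<in> row (Suc n)"
  shows "a1 x \<in> row n" "a2 x \<in> row n"
proof -
  have "1 + (\<pi> + of_nat (Suc n)) = \<pi> + of_nat n"
    by (cases \<pi>; cases "of_nat n :: bit") simp_all
  then show "a1 x \<in> row n" "a2 x \<in> row n"
    using odd_ops(1,2)[THEN inder_part_maps, OF row_V[OF assms]] row_z[OF assms]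
    by (simp_all only: row_def mem_Collect_eq z_rels a1.scale a2.scale of_nat_Suc)
      (simp_all add: algebra_simps)
qed

text \<open>The even operators preserve each row, \<open>b1\<close> and \<open>b2\<close> pass to
  the next one, and \<open>a1\<close> and \<open>a2\<close> pass to the previous one or kill row 0.
  Irreducibility gives the rest.\<close>

lemma span_rows: "span (\<Union>n. row n) = UNIV"
proof (rule span_eq_UNIV)
  show "\<exists>\<alpha>. x \<in> V \<alpha>" if "x \<in> (\<Union>n. row n)" for x
    using that row_V by blast
  show "t \<in> (\<Union>n. row n)" using t_row by blast
  fix x assume "x \<in> (\<Union>n. row n)"
  then obtain n where n: "x \<in> row n" by blast
  show "e x \<in> span (\<Union>n. row n)" "f x \<in> span (\<Union>n. row n)" "h x \<in> span (\<Union>n. row n)"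
    "z x \<in> span (\<Union>n. row n)" "b1 x \<in> span (\<Union>n. row n)" "b2 x \<in> span (\<Union>n. row n)"
    using even_row[OF n] b_row[OF n] by (auto intro: span_base)
  show "a1 x \<in> span (\<Union>n. row n)" "a2 x \<in> span (\<Union>n. row n)"
  proof (atomize (full), cases n)
    case 0
    then show "a1 x \<in> span (\<Union>n. row n) \<and> a2 x \<in> span (\<Union>n. row n)"
      using n a_row_0 span_zero by simp
  next
    case (Suc m)
    then have "a1 x \<in> row m" "a2 x \<in> row m" using n a_row_Suc by simp_all
    then show "a1 x \<in> span (\<Union>n. row n) \<and> a2 x \<in> span (\<Union>n. row n)"
      by (blast intro: span_base)
  qed
qed (rule t)

section \<open>Charges of left multiplications\<close>

text \<open>\<open>ns\<close> records the rows of the entries: entry \<open>i\<close> has charge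
  \<open>p - ns ! i\<close>.\<close>

definition tuple :: "'b list \<Rightarrow> nat list \<Rightarrow> bool" where
  "tuple u ns \<longleftrightarrow> length u = r - 1 \<and> list_all2 (\<lambda>x n. x \<in> row n) u ns"

text \<open>The total charge of the entries, which is the amount by which the left multiplication
  shifts the charge.\<close>

definition weight :: "nat list \<Rightarrow> 'a" where
  "weight ns = of_nat (r - 1) * p - of_nat (sum_list ns)"

lemma tuple_length: "tuple u ns \<Longrightarrow> length u = r - 1" "tuple u ns \<Longrightarrow> length ns = r - 1"
  by (auto simp: tuple_def dest: list_all2_lengthD)

lemma tuple_nth: "tuple u ns \<Longrightarrow> i < r - 1 \<Longrightarrow> u ! i \<in> row (ns ! i)"
  by (auto simp: tuple_def list_all2_conv_all_nth)

lemma tuple_update: "tuple u ns \<Longrightarrow> x \<in> row n \<Longrightarrow> tuple (u[i := x]) (ns[i := n])"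
  by (simp add: tuple_def list_all2_update_cong)

lemma tuple_homog:
  assumes u: "tuple u ns"
  shows "homog V (map (\<lambda>n. \<pi> + of_nat n) ns) u"
  unfolding homog_def
proof (rule list_all2_all_nthI)
  show "length (map (\<lambda>n. \<pi> + of_nat n) ns) = length u"
    using tuple_length[OF u] by simp
  fix i assume "i < length (map (\<lambda>n. \<pi> + of_nat n) ns)"
  then have i: "i < length ns" "i < r - 1" using tuple_length[OF u] by simp_all
  show "u ! i \<in> V (map (\<lambda>n. \<pi> + of_nat n) ns ! i)"
    unfolding nth_map[OF i(1)] by (rule row_V[OF tuple_nth[OF u i(2)]])
qed

lemma tuple_exists:
  assumes "length u = r - 1" "set u \<subseteq> (\<Union>n. row n)"
  shows "\<exists>ns. tuple u ns"
proof -
  have "\<exists>ns. list_all2 (\<lambda>x n. x \<in> row n) u ns"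
    using assms(2)
  proof (induction u)
    case Nil
    show ?case by (rule exI[of _ "[]"]) simp
  next
    case (Cons x u)
    then obtain n ns where "x \<in> row n" "list_all2 (\<lambda>x n. x \<in> row n) u ns" by auto
    then have "list_all2 (\<lambda>x n. x \<in> row n) (x # u) (n # ns)" by simp
    then show ?case by blast
  qed
  then show ?thesis using assms(1) by (simp add: tuple_def)
qed

lemma left_mult_in_inder: "tuple u ns \<Longrightarrow> left_mult u \<in> inder"
  by (intro op.span_base imageI) (simp add: tuple_length)

text \<open>In the derivation rule \<open>z\<close> multiplies each entry by its charge, and the
  charges add up.\<close>

lemma z_left_mult:
  assumes u: "tuple u ns"
  shows "z (left_mult u w) - left_mult u (z w) = weight ns \<cdot> left_mult u w"
proof -
  note l = tuple_length[OF u]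
  have *: "left_mult (u[i := z (u ! i)]) w = (p - of_nat (ns ! i)) \<cdot> left_mult u w" if "i < r - 1" for i
    unfolding row_z[OF tuple_nth[OF u that]] left_mult_update_linear(2)[OF l(1) that] by simp
  have "z (left_mult u w) - left_mult u (z w) = (\<Sum>i<r - 1. left_mult (u[i := z (u ! i)]) w)"
    using commutator_left_mult[OF even_ops(4) l(1) tuple_homog[OF u], of w]
    by (simp only: mult_zero_left sgn_act_0)
  also have "\<dots> = (\<Sum>i<r - 1. (p - of_nat (ns ! i)) \<cdot> left_mult u w)"
    by (rule sum.cong) (simp_all only: * lessThan_iff)
  also have "\<dots> = (\<Sum>i<r - 1. p - of_nat (ns ! i)) \<cdot> left_mult u w"
    by (rule scale_sum_left[symmetric])
  also have "(\<Sum>i<r - 1. p - of_nat (ns ! i)) = weight ns"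
    using l(2) by (simp add: weight_def sum_subtractf sum_list_sum_nth atLeast0LessThan)
  finally show ?thesis .
qed

lemma weight_coord: "tuple u ns \<Longrightarrow> j < 8 \<Longrightarrow> coord (left_mult u) j \<noteq> 0 \<Longrightarrow> weight ns = ad_weight j"
  by (rule coord_ad_weight[OF left_mult_in_inder z_left_mult])

text \<open>A left multiplication that does not vanish has a nonzero coordinate, and the charges of
  sl(2,1) are -1, 0 and 1.\<close>

lemma weight_left_mult:
  assumes u: "tuple u ns" and nz: "left_mult u w \<noteq> 0"
  shows "weight ns \<in> {- 1, 0, 1}"
proof (rule ccontr)
  assume neg: "weight ns \<notin> {- 1, 0, 1}"
  have "coord (left_mult u) j = 0" if "j < 8" for j
  proof (rule ccontr)
    assume "coord (left_mult u) j \<noteq> 0"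
    then show False
      using weight_coord[OF u that] neg by (simp add: ad_weight_def split: if_splits)
  qed
  then have "comb (coord (left_mult u)) w = 0"
    by (simp add: comb_def)
  then show False
    using nz comb_coord[OF left_mult_in_inder[OF u], of w] by simp
qed

lemma weight_update:
  assumes "tuple u ns" "i < r - 1"
  shows "weight (ns[i := n]) = weight ns + of_nat (ns ! i) - of_nat n"
proof -
  have "n + sum_list ns = sum_list (ns[i := n]) + ns ! i" if "i < length ns" for i and ns :: "nat list"
    using that by (induction ns arbitrary: i) (auto split: nat.split)
  from this[of i ns] have "of_nat n + of_nat (sum_list ns) =
      (of_nat (sum_list (ns[i := n])) + of_nat (ns ! i) :: 'a)"
    using assms tuple_length(2) by (metis of_nat_add)
  then show ?thesis by (simp add: weight_def algebra_simps)
qed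

text \<open>Exchanging \<open>w\<close> with \<open>u ! i\<close> gives a nonzero left
  multiplication of weight \<open>ns ! i - n\<close>, which must be -1, 0 or 1.\<close>

lemma rows_adjacent:
  assumes u: "tuple u ns" and w0: "weight ns = 0" and i: "i < r - 1"
    and w: "w \<in> row n" "left_mult u w \<noteq> 0"
  shows "ns ! i \<le> Suc n \<and> n \<le> Suc (ns ! i)"
proof -
  have "left_mult (u[i := w]) (u ! i) \<noteq> 0"
    using w(2) left_mult_swap[OF tuple_length(1)[OF u] tuple_homog[OF u] i row_V[OF w(1)]] by simp
  then have "weight (ns[i := n]) \<in> {- 1, 0, 1}"
    using weight_left_mult[OF tuple_update[OF u w(1)]] by blast
  then have "of_nat (ns ! i) - of_nat n \<in> {- 1, 0, 1 :: 'a}"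
    using w0 unfolding weight_update[OF u i] by simp
  then consider "of_nat (Suc (ns ! i)) = (of_nat n :: 'a)" | "of_nat (ns ! i) = (of_nat n :: 'a)"
    | "of_nat (ns ! i) = (of_nat (Suc n) :: 'a)"
    by (auto simp: algebra_simps)
  then show ?thesis by cases (simp_all only: of_nat_eq_iff, simp_all)
qed

text \<open>If \<open>s + \<zeta> z\<close> with \<open>s \<in> sl(2)\<close> vanishes on a row of nonzero charge, then \<open>s\<close> is a nonzero
  scalar there. Commuting with \<open>h\<close> and then with \<open>e\<close> and \<open>f\<close> shows that \<open>sl(2)\<close>, hence \<open>s\<close>, acts by zero.\<close>

lemma row_not_killed:
  assumes u: "tuple u ns" and \<zeta>: "coord (left_mult u) 3 \<noteq> 0"
    and n: "x \<in> row n" "x \<noteq> 0" "p \<noteq> of_nat n"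
  shows "\<exists>w\<in>row n. left_mult u w \<noteq> 0"
proof (rule ccontr)
  assume neg: "\<not> ?thesis"
  have w0: "weight ns = 0"
    using weight_coord[OF u _ \<zeta>] by (simp add: ad_weight_def)
  have c: "coord (left_mult u) j = 0" if "j \<in> {4, 5, 6, 7}" for j
  proof (rule ccontr)
    assume "coord (left_mult u) j \<noteq> 0"
    then show False
      using weight_coord[OF u, of j] that w0 by (auto simp: ad_weight_def)
  qed
  define \<alpha> \<beta> \<gamma> where "\<alpha> = coord (left_mult u) 0" and "\<beta> = coord (left_mult u) 1"
    and "\<gamma> = coord (left_mult u) 2"
  define \<kappa> where "\<kappa> = - coord (left_mult u) 3 * (p - of_nat n)"
  have \<kappa>: "\<kappa> \<noteq> 0" using \<zeta> n(3) by (simp add: \<kappa>_def)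
  have K: "\<alpha> \<cdot> e w + \<beta> \<cdot> f w + \<gamma> \<cdot> h w = \<kappa> \<cdot> w" if w: "w \<in> row n" for w
  proof -
    have "0 = comb (coord (left_mult u)) w"
      using neg w comb_coord[OF left_mult_in_inder[OF u], of w] by simp
    then have "\<alpha> \<cdot> e w + \<beta> \<cdot> f w + \<gamma> \<cdot> h w + coord (left_mult u) 3 \<cdot> z w = 0"
      by (simp add: comb_def c \<alpha>_def \<beta>_def \<gamma>_def)
    then show ?thesis
      by (simp add: row_z[OF w] \<kappa>_def eq_neg_iff_add_eq_0)
  qed
  \<comment> \<open>Apply \<open>h\<close> to \<open>K\<close> at \<open>w\<close> and subtract
    \<open>K\<close> at \<open>h w\<close>; the relations \<open>[h, e] = 2 e\<close> and
    \<open>[h, f] = - 2 f\<close> leave this equation.\<close>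
  have 1: "\<alpha> \<cdot> e w = \<beta> \<cdot> f w" if w: "w \<in> row n" for w
  proof -
    have "\<alpha> \<cdot> h (e w) + \<beta> \<cdot> h (f w) + \<gamma> \<cdot> h (h w) = \<kappa> \<cdot> h w"
      using arg_cong[OF K[OF w], of h] by (simp only: h.add h.scale)
    then have "(\<alpha> \<cdot> h (e w) + \<beta> \<cdot> h (f w) + \<gamma> \<cdot> h (h w)) -
        (\<alpha> \<cdot> e (h w) + \<beta> \<cdot> f (h w) + \<gamma> \<cdot> h (h w)) = 0"
      by (simp only: K[OF even_row(3)[OF w]] diff_self)
    then have "2 \<cdot> (\<alpha> \<cdot> e w - \<beta> \<cdot> f w) = 0"
      by (simp add: sl2_rels(1,2) algebra_simps)
    then show ?thesis by simp
  qed
  \<comment> \<open>The same comparison for \<open>1\<close> yields the equation with the opposite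
    sign, so both terms vanish.\<close>
  have 2: "\<alpha> \<cdot> e w = 0 \<and> \<beta> \<cdot> f w = 0" if w: "w \<in> row n" for w
  proof -
    have "\<alpha> \<cdot> h (e w) = \<beta> \<cdot> h (f w)"
      using arg_cong[OF 1[OF w], of h] by (simp only: h.scale)
    then have "\<alpha> \<cdot> h (e w) - \<alpha> \<cdot> e (h w) - (\<beta> \<cdot> h (f w) - \<beta> \<cdot> f (h w)) = 0"
      by (simp only: 1[OF even_row(3)[OF w]] diff_self)
    then have "2 \<cdot> (\<alpha> \<cdot> e w + \<beta> \<cdot> f w) = 0"
      by (simp add: sl2_rels(1,2) algebra_simps)
    then have "(2 + 2) \<cdot> (\<alpha> \<cdot> e w) = 0"
      unfolding scale_left_distrib scale_right_distrib 1[OF w] by simp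
    then show ?thesis using 1[OF w] by auto
  qed
  then have 3: "\<gamma> \<cdot> h w = \<kappa> \<cdot> w" if "w \<in> row n" for w
    using K[OF that] 2[OF that] by simp
  then have \<gamma>: "\<gamma> \<noteq> 0"
    using n \<kappa> by (metis scale_eq_0_iff)
  have "e w = 0" if w: "w \<in> row n" for w
  proof -
    have "\<gamma> \<cdot> e (h w) = \<gamma> \<cdot> h (e w)"
      using arg_cong[OF 3[OF w], of e] 3[OF even_row(1)[OF w]] by (simp add: e.scale)
    then show ?thesis using \<gamma> by (simp add: sl2_rels)
  qed
  then have "h x = 0"
    using sl2_rels(3)[of x] n(1) even_row(2)[OF n(1)] by (simp add: f.zero)
  then show False using 3[OF n(1)] \<kappa> n(2) by simp
qed

lemma ex_tuple_coord: "j < 8 \<Longrightarrow> \<exists>u ns. tuple u ns \<and> coord (left_mult u) j \<noteq> 0"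
  using ex_left_mult_coord[OF span_rows] tuple_exists by blast

section \<open>Highest weight vectors and the Kac determinant\<close>

text \<open>An \<open>h\<close>-eigenvector of row 0 with top eigenvalue \<open>m\<close> is killed
  by \<open>e\<close>, which raises the eigenvalue by 2. The string \<open>f^k v\<close> ends by
  finite dimension, and at its last member the factor \<open>(k + 1) (m - k)\<close> vanishes, so
  \<open>m = k\<close>.\<close>

lemma ex_highest_weight_vector:
  "\<exists>m v. v \<in> row 0 \<and> v \<noteq> 0 \<and> h v = of_nat m \<cdot> v \<and> e v = 0"
proof -
  have "\<exists>m v. v \<in> row 0 \<and> v \<noteq> 0 \<and> h v = m \<cdot> v \<and> (\<forall>w\<in>row 0. h w = (m + 2) \<cdot> w \<longrightarrow> w = 0)"
    by (rule ex_top_eigenvector[of smul Bs h "row 0" t 2])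
      (use even_row(3) in \<open>auto simp: finite_dimensional_vector_space_axioms h.linear_axioms
          row_subspace t_row t\<close>)
  then obtain m v where v: "v \<in> row 0" "v \<noteq> 0" "h v = m \<cdot> v"
    "\<forall>w\<in>row 0. h w = (m + 2) \<cdot> w \<longrightarrow> w = 0"
    by blast
  have "h (e v) = (m + 2) \<cdot> e v"
    by (simp add: sl2_rels(1) v(3) e.scale scale_left_distrib)
  then have ev: "e v = 0" using v(4) even_row(1)[OF v(1)] by blast
  define w where "w k = (f ^^ k) v" for k
  have hw: "h (w k) = (m - 2 * of_nat k) \<cdot> w k" for k
  proof (induction k)
    case (Suc k)
    then show ?case
      by (simp add: w_def sl2_rels(2) f.scale f.diff scale_left_distrib scale_left_diff_distrib)
  qed (simp add: w_def v(3))
  have ew: "e (w (Suc k)) = (of_nat (Suc k) * (m - of_nat k)) \<cdot> w k" for k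
  proof (induction k)
    case 0
    then show ?case by (simp add: w_def sl2_rels(3) ev f.zero v(3))
  next
    case (Suc k)
    have "e (w (Suc (Suc k))) = f (e (w (Suc k))) + h (w (Suc k))"
      by (simp add: w_def sl2_rels(3))
    also have "\<dots> = (of_nat (Suc k) * (m - of_nat k) + (m - 2 * of_nat (Suc k))) \<cdot> w (Suc k)"
      unfolding Suc hw f.scale by (simp add: w_def scale_left_distrib)
    also have "of_nat (Suc k) * (m - of_nat k) + (m - 2 * of_nat (Suc k)) =
        of_nat (Suc (Suc k)) * (m - of_nat (Suc k))"
      by (simp add: algebra_simps)
    finally show ?case .
  qed
  have "\<exists>k. w k = 0"
  proof (rule ccontr)
    assume "\<nexists>k. w k = 0"
    then have nz: "w k \<noteq> 0" for k by blast
    have "inj (\<lambda>k::nat. m - 2 * of_nat k)" by (auto intro: injI)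
    from eigenvalues_not_infinite[OF h.linear_axioms this nz hw] show False .
  qed
  moreover have "w 0 \<noteq> 0" using v(2) by (simp add: w_def)
  ultimately obtain k where k: "w k \<noteq> 0" "w (Suc k) = 0"
    using nat_induct[of "\<lambda>k. w k \<noteq> 0"] by blast
  then have "of_nat (Suc k) * (m - of_nat k) = 0"
    using ew[of k] by (simp only: e.zero scale_eq_0_iff[symmetric]) (metis scale_eq_0_iff)
  then have "m = of_nat k" by (simp del: of_nat_Suc)
  then show ?thesis using v ev by blast
qed

text \<open>\<open>(p + m) / 2\<close> and \<open>(p - m) / 2\<close> are the eigenvalues
  \<open>\<nu>\<^sub>1\<close> and \<open>\<nu>\<^sub>2\<close> of \<open>E11 + E33\<close> and
  \<open>E22 + E33\<close> on \<open>v\<close>. The operators \<open>a2\<close> and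
  \<open>a1\<close> are moved to the right, where they kill row 0. A nonzero value shows that row 2
  contains the nonzero vector \<open>b1 (b2 v)\<close>.\<close>

lemma kac_determinant:
  assumes v: "v \<in> row 0" "e v = 0" "h v = m \<cdot> v"
  shows "a1 (a2 (b1 (b2 v))) = ((p + m) / 2 * (1 - (p - m) / 2)) \<cdot> v"
proof -
  have zv: "z v = p \<cdot> v" using row_z[OF v(1)] by simp
  have a2b2: "a2 (b2 v) = ((p - m) / 2) \<cdot> v"
    by (simp add: ab_rels(4) zv v(3) a_row_0[OF v(1)] b2.zero flip: scale_left_diff_distrib)
  have a1b1: "a1 (b1 v) = ((p + m) / 2) \<cdot> v"
    by (simp add: ab_rels(1) zv v(3) a_row_0[OF v(1)] b1.zero flip: scale_left_distrib)
  have "a2 (b1 (b2 v)) = (1 - (p - m) / 2) \<cdot> b1 v"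
    by (simp add: ab_rels(3) b_rels(2) v(2) b2.zero a2b2 b1.scale scale_left_diff_distrib)
  then show ?thesis by (simp add: a1.scale a1b1 mult.commute)
qed

section \<open>Determination of the charges\<close>

text \<open>A nonzero row of nonzero charge forces all entries of \<open>u\<close> into its own or
  an adjacent row. Row 0 bounds \<open>ns ! i\<close> by 1 and hence
  \<open>(r - 1) p = sum_list ns\<close> by \<open>r - 1\<close>. Then the Kac determinant is
  nonzero, and row 2 bounds \<open>ns ! i\<close> below by 1. Weight 0 finally gives
  \<open>p = 1\<close>.\<close>

lemma concentrated:
  assumes u: "tuple u ns" and \<zeta>: "coord (left_mult u) 3 \<noteq> 0"
  shows "p = 1" "i < r - 1 \<Longrightarrow> ns ! i = 1"
proof -
  have w0: "weight ns = 0"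
    using weight_coord[OF u _ \<zeta>] by (simp add: ad_weight_def)
  then have sum: "of_nat (r - 1) * p = of_nat (sum_list ns)"
    by (simp add: weight_def)
  \<comment> \<open>A left multiplication involving \<open>a1\<close> has weight 1, so
    \<open>(r - 1) p\<close> is a positive integer. This excludes \<open>p = 0\<close> and later
    \<open>p = - m\<close>.\<close>
  obtain u' ns' where u': "tuple u' ns'" "coord (left_mult u') 4 \<noteq> 0"
    using ex_tuple_coord[of 4] by auto
  have "weight ns' = 1"
    using weight_coord[OF u'(1) _ u'(2)] by (simp add: ad_weight_def)
  then have sum': "of_nat (r - 1) * p = of_nat (Suc (sum_list ns'))"
    by (simp add: weight_def algebra_simps)
  have near: "ns ! i \<le> Suc n \<and> n \<le> Suc (ns ! i)"
    if "x \<in> row n" "x \<noteq> 0" "p \<noteq> of_nat n" "i < r - 1" for x n i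
    using row_not_killed[OF u \<zeta> that(1-3)] rows_adjacent[OF u w0 that(4)] by blast
  have p0: "p \<noteq> 0"
  proof
    assume "p = 0"
    then have "of_nat (Suc (sum_list ns')) = (0 :: 'a)" using sum' by simp
    then show False by (simp only: of_nat_eq_0_iff)
  qed
  have le1: "ns ! i \<le> 1" if "i < r - 1" for i
    using near[OF t_row t(2) _ that] p0 by simp
  have "sum_list ns = (\<Sum>i<r - 1. ns ! i)"
    using tuple_length(2)[OF u] by (simp add: sum_list_sum_nth atLeast0LessThan)
  also have "\<dots> \<le> (\<Sum>i<r - 1. 1)"
    by (intro sum_mono le1) simp
  finally have sum_le: "sum_list ns \<le> r - 1" by simp
  obtain m v where v: "v \<in> row 0" "v \<noteq> 0" "h v = of_nat m \<cdot> v" "e v = 0"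
    using ex_highest_weight_vector by blast
  have "b1 (b2 v) \<noteq> 0"
  proof
    assume "b1 (b2 v) = 0"
    then have "(p + of_nat m) / 2 * (1 - (p - of_nat m) / 2) = 0"
      using kac_determinant[OF v(1,4,3)] v(2) by (simp add: a1.zero a2.zero)
    then have "p + of_nat m = 0 \<or> (p - of_nat m) / 2 = 1"
      by auto
    then have "p + of_nat m = 0 \<or> p = of_nat (m + 2)"
      by (auto simp: divide_eq_1_iff diff_eq_eq)
    then show False
    proof
      assume p: "p + of_nat m = 0"
      have "of_nat (Suc (sum_list ns') + (r - 1) * m) = of_nat (r - 1) * (p + of_nat m)"
        unfolding distrib_left sum' by simp
      also have "\<dots> = 0" by (simp only: p mult_zero_right)
      finally show False by (simp only: of_nat_eq_0_iff)
    next
      \<comment> \<open>The other zero of the determinant would make \<open>(r - 1) p\<close> at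
        least \<open>2 (r - 1)\<close>, against \<open>sum_le\<close>.\<close>
      assume "p = of_nat (m + 2)"
      then have "of_nat ((r - 1) * (m + 2)) = (of_nat (sum_list ns) :: 'a)"
        using sum by (simp only: of_nat_mult)
      then have "(r - 1) * (m + 2) = sum_list ns" by (simp only: of_nat_eq_iff)
      moreover have "(r - 1) * 2 \<le> (r - 1) * (m + 2)" by (rule mult_le_mono) simp_all
      ultimately show False using sum_le arity_ge_3 by linarith
    qed
  qed
  moreover have "b1 (b2 v) \<in> row 2"
    using b_row(1)[OF b_row(2)[OF v(1)]] by (simp only: numeral_2_eq_2)
  moreover have "p \<noteq> of_nat 2"
  proof
    assume "p = of_nat 2"
    then have "of_nat ((r - 1) * 2) = (of_nat (sum_list ns) :: 'a)"
      using sum by (simp only: of_nat_mult)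
    then have "(r - 1) * 2 = sum_list ns" by (simp only: of_nat_eq_iff)
    then show False using sum_le arity_ge_3 by simp
  qed
  ultimately have "2 \<le> Suc (ns ! i)" if "i < r - 1" for i
    using near that by blast
  with le1 have one: "ns ! i = 1" if "i < r - 1" for i
    using that by (simp add: le_antisym)
  then show "i < r - 1 \<Longrightarrow> ns ! i = 1" .
  have "sum_list ns = r - 1"
    using tuple_length(2)[OF u] one by (simp add: sum_list_sum_nth)
  then have "of_nat (r - 1) * (p - 1) = 0"
    using sum by (simp add: algebra_simps)
  moreover have "of_nat (r - 1) \<noteq> (0 :: 'a)" using arity_ge_3 by (simp only: of_nat_eq_0_iff)
  ultimately show "p = 1" by simp
qed

lemma coord_eq_0:
  assumes "tuple u ns" "j < 8" "weight ns \<noteq> ad_weight j"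
  shows "coord (left_mult u) j = 0"
  using weight_coord[OF assms(1,2)] assms(3) by blast

lemma left_mult_weight_0:
  assumes u: "tuple u ns" and w0: "weight ns = 0"
  shows "left_mult u x = coord (left_mult u) 0 \<cdot> e x + coord (left_mult u) 1 \<cdot> f x +
    coord (left_mult u) 2 \<cdot> h x + coord (left_mult u) 3 \<cdot> z x"
proof -
  have "coord (left_mult u) j = 0" if "j \<in> {4, 5, 6, 7}" for j
    using that w0 by (intro coord_eq_0[OF u]) (auto simp: ad_weight_def)
  then show ?thesis
    using comb_coord[OF left_mult_in_inder[OF u], of x] by (simp add: comb_def)
qed

lemma left_mult_weight_1:
  assumes u: "tuple u ns" and w1: "weight ns = 1"
  shows "left_mult u x = coord (left_mult u) 4 \<cdot> a1 x + coord (left_mult u) 5 \<cdot> a2 x"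
proof -
  have "coord (left_mult u) j = 0" if "j \<in> {0, 1, 2, 3, 6, 7}" for j
    using that w1 by (intro coord_eq_0[OF u]) (auto simp: ad_weight_def)
  then show ?thesis
    using comb_coord[OF left_mult_in_inder[OF u], of x] by (simp add: comb_def)
qed

section \<open>Traces on the rows\<close>

text \<open>\<open>2 e\<close>, \<open>- 2 f\<close> and \<open>h\<close> are commutators of
  operators that preserve the row, and the trace of a commutator is 0.\<close>

lemma trace_sl2:
  assumes B: "finite B" "independent B" "span B = row n"
  shows "trace_on smul B e = 0" "trace_on smul B f = 0" "trace_on smul B h = 0"
proof -
  have in_B: "b \<in> row n" if "b \<in> B" for b using that B(3) span_base by blast
  note rows = even_row[OF in_B, folded B(3)]
  have rows2: "D x \<in> span B" if "x \<in> span B" "\<And>x. x \<in> row n \<Longrightarrow> D x \<in> row n" for D x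
    using that B(3) by simp
  note add = trace_on_add[OF B(1,2)] and scale = trace_on_scale[OF B(1,2)]
  note commute = trace_on_comp_commute[OF B(1,2)]
  have "trace_on smul B (\<lambda>x. h (e x)) = trace_on smul B (\<lambda>x. e (h x)) + 2 * trace_on smul B e"
    unfolding sl2_rels(1)
    by (subst add) (auto simp: scale rows rows2 even_row span_scale)
  moreover have "trace_on smul B (\<lambda>x. h (e x)) = trace_on smul B (\<lambda>x. e (h x))"
    by (rule commute[OF h.linear_axioms rows(3) e.linear_axioms rows(1)])
  ultimately show "trace_on smul B e = 0" by simp
  have "trace_on smul B (\<lambda>x. f (h x)) = trace_on smul B (\<lambda>x. h (f x)) + 2 * trace_on smul B f"
    unfolding sl2_rels(2)
    by (subst scale[symmetric], simp add: rows, subst add[symmetric])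
      (auto simp: scale rows rows2 even_row span_scale span_diff)
  moreover have "trace_on smul B (\<lambda>x. h (f x)) = trace_on smul B (\<lambda>x. f (h x))"
    by (rule commute[OF h.linear_axioms rows(3) f.linear_axioms rows(2)])
  ultimately show "trace_on smul B f = 0" by simp
  have "trace_on smul B (\<lambda>x. e (f x)) = trace_on smul B (\<lambda>x. f (e x)) + trace_on smul B h"
    unfolding sl2_rels(3)
    by (subst add) (auto simp: scale rows rows2 even_row span_scale)
  moreover have "trace_on smul B (\<lambda>x. e (f x)) = trace_on smul B (\<lambda>x. f (e x))"
    by (rule commute[OF e.linear_axioms rows(1) f.linear_axioms rows(2)])
  ultimately show "trace_on smul B h = 0" by simp
qed

text \<open>The scalar counterpart of \<open>sgn_act\<close>, for use in identities between
  traces.\<close>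

definition sign :: "bit \<Rightarrow> 'a" where
  "sign \<alpha> = (if \<alpha> = 0 then 1 else - 1)"

lemma sgn_act_sign: "sgn_act \<alpha> x = sign \<alpha> \<cdot> x"
  by (simp add: sgn_act_def sign_def)

lemma sign_add: "sign (\<alpha> + \<beta>) = sign \<alpha> * sign \<beta>"
  by (cases \<alpha>; cases \<beta>) (simp_all add: sign_def)

lemma sign_square: "sign \<alpha> * sign \<alpha> = 1"
  by (simp add: sign_def)

section \<open>Two computations of a trace for a tuple with nonzero
  \<open>z\<close>-coordinate\<close>

context
  fixes u ns assumes u: "tuple u ns" and \<zeta>: "coord (left_mult u) 3 \<noteq> 0"
begin

lemma weight_ns: "weight ns = 0"
  using weight_coord[OF u _ \<zeta>] by (simp add: ad_weight_def)

lemma map_parities: "map (\<lambda>n. \<pi> + of_nat n) ns = replicate (r - 1) (\<pi> + 1)"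
  by (rule nth_equalityI) (simp_all only: length_map length_replicate tuple_length[OF u] nth_map
      nth_replicate concentrated(2)[OF u \<zeta>] of_nat_1)

lemma u_homog: "homog V (replicate (r - 1) (\<pi> + 1)) u"
  using tuple_homog[OF u] by (simp only: map_parities)

text \<open>All entries lie in row 1, so this is the parity of \<open>L(u)\<close>. An operator of
  weight 0 is a combination of the even generators, and \<open>L(u)\<close> is nonzero, so it is not
  odd.\<close>

lemma parity_zero: "of_nat (r - 1) * (\<pi> + 1) = (0 :: bit)"
proof (rule ccontr)
  assume "of_nat (r - 1) * (\<pi> + 1) \<noteq> (0 :: bit)"
  then have 1: "of_nat (r - 1) * (\<pi> + 1) = 0 + (1 :: bit)"
    by (metis bit_not_zero_iff add_0)
  have "left_mult u \<in> end_part smul V (0 + 1)"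
    using left_mult_end_part[OF tuple_length(1)[OF u] u_homog] unfolding sum_list_replicate 1 .
  moreover have "left_mult u \<in> end_part smul V 0"
  proof -
    have eq: "left_mult u = end_scale smul (coord (left_mult u) 0) e + end_scale smul (coord (left_mult u) 1) f +
        end_scale smul (coord (left_mult u) 2) h + end_scale smul (coord (left_mult u) 3) z"
      by (rule ext, subst left_mult_weight_0[OF u weight_ns]) (simp add: end_scale_def)
    have even: "D \<in> end_part smul V 0" if "D \<in> inder_part 0" for D
      using inder_part_subset that by blast
    show ?thesis
      by (subst eq) (intro op.subspace_add[OF op_subspace_end_part]
          op.subspace_scale[OF op_subspace_end_part] even even_ops)
  qed
  ultimately have "left_mult u = 0" by (intro end_part_inter)
  then show False using \<zeta> coord_zero[of 3] by simp
qed

text \<open>The trace of the map sending \<open>D\<close> to \<open>L(u[i := D (u ! i)])\<close> on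
  the span of \<open>a1\<close> and \<open>a2\<close>, whose coordinates have the indices 4 and
  5.\<close>

definition odd_trace where
  "odd_trace i = coord (left_mult (u[i := a1 (u ! i)])) 4 + coord (left_mult (u[i := a2 (u ! i)])) 5"

lemma u_row: "i < r - 1 \<Longrightarrow> u ! i \<in> row 1"
  using tuple_nth[OF u] concentrated(2)[OF u \<zeta>] by fastforce

lemma au_row: "i < r - 1 \<Longrightarrow> a1 (u ! i) \<in> row 0" "i < r - 1 \<Longrightarrow> a2 (u ! i) \<in> row 0"
  using a_row_Suc[of _ 0] u_row by simp_all

text \<open>Replacing an entry of row 1 by one of row 0 raises the weight from 0 to 1, the weight of
  \<open>a1\<close> and \<open>a2\<close>.\<close>

lemma left_mult_update_row_0:
  assumes i: "i < r - 1" and x: "x \<in> row 0"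
  shows "left_mult (u[i := x]) w =
    coord (left_mult (u[i := x])) 4 \<cdot> a1 w + coord (left_mult (u[i := x])) 5 \<cdot> a2 w"
proof (rule left_mult_weight_1)
  show "tuple (u[i := x]) (ns[i := 0])" by (rule tuple_update[OF u x])
  show "weight (ns[i := 0]) = 1"
    using weight_update[OF u i, of 0] weight_ns concentrated(2)[OF u \<zeta> i] by simp
qed

lemma update_coord_linear:
  assumes i: "i < r - 1" and j: "j < 8"
  shows "coord (left_mult (u[i := x + y])) j = coord (left_mult (u[i := x])) j + coord (left_mult (u[i := y])) j"
    "coord (left_mult (u[i := c \<cdot> x])) j = c * coord (left_mult (u[i := x])) j"
proof -
  have l: "length u = r - 1" by (rule tuple_length[OF u])
  have "left_mult (u[i := x]) \<in> inder" for x
    by (intro op.span_base imageI) (simp add: l)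
  note inder = this
  have 1: "left_mult (u[i := x + y]) = left_mult (u[i := x]) + left_mult (u[i := y])"
    and 2: "left_mult (u[i := c \<cdot> x]) = end_scale smul c (left_mult (u[i := x]))"
    using left_mult_update_linear[OF l i] by (simp_all add: fun_eq_iff end_scale_def)
  show "coord (left_mult (u[i := x + y])) j = coord (left_mult (u[i := x])) j + coord (left_mult (u[i := y])) j"
    unfolding 1 by (rule coord_add[OF inder inder j])
  show "coord (left_mult (u[i := c \<cdot> x])) j = c * coord (left_mult (u[i := x])) j"
    unfolding 2 by (rule coord_scale[OF inder j])
qed

text \<open>Exchanging \<open>x\<close> with \<open>u ! i\<close> writes \<open>L(u)\<close> on row
  0 as a signed sum of two operators of rank at most one, with values in the lines of
  \<open>a1 (u ! i)\<close> and \<open>a2 (u ! i)\<close>. The trace of each is its functional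
  evaluated at that vector.\<close>

lemma trace_eq_odd_trace:
  assumes B: "finite B" "independent B" "span B = row 0" and i: "i < r - 1"
  shows "trace_on smul B (left_mult u) = sign (of_nat i * (\<pi> + 1) + \<pi>) * odd_trace i"
proof -
  \<comment> \<open>The exchange produces a sign that counts the entries after \<open>i\<close>;
    \<open>parity_zero\<close> converts it, up to \<pi>, into the count of the entries before
    \<open>i\<close> that occurs in the commutator formula.\<close>
  define s where "s = 1 + of_nat (r - 1 - Suc i) * (\<pi> + 1)"
  have s: "s = of_nat i * (\<pi> + 1) + \<pi>"
  proof -
    have "r - 1 = Suc (i + (r - 1 - Suc i))" using i by simp
    then have "of_nat (r - 1) = 1 + (of_nat i + of_nat (r - 1 - Suc i) :: bit)"
      by (metis of_nat_Suc of_nat_add)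
    then have "(1 + (of_nat i + of_nat (r - 1 - Suc i))) * (\<pi> + 1) = (0 :: bit)"
      using parity_zero by simp
    then show ?thesis
      unfolding s_def by (cases \<pi>; cases "of_nat i :: bit"; cases "of_nat (r - 1 - Suc i) :: bit") simp_all
  qed
  have L: "left_mult u x = sign s \<cdot> (coord (left_mult (u[i := x])) 4 \<cdot> a1 (u ! i) +
      coord (left_mult (u[i := x])) 5 \<cdot> a2 (u ! i))" if x: "x \<in> row 0" for x
  proof -
    have xV: "x \<in> V \<pi>" using row_V[OF x] by (simp only: of_nat_0 add_0_right)
    have "1 + (\<pi> + 1) * \<pi> + (\<pi> + 1 + \<pi>) * (of_nat (r - 1 - Suc i) * (\<pi> + 1)) = s"
      unfolding s_def by (cases \<pi>) simp_all
    then have "left_mult u x = sgn_act s (left_mult (u[i := x]) (u ! i))"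
      using left_mult_swap[OF tuple_length(1)[OF u] u_homog i xV] i
      by (simp only: nth_replicate drop_replicate sum_list_replicate)
    then show ?thesis
      by (simp only: sgn_act_sign left_mult_update_row_0[OF i x])
  qed
  have in_B: "b \<in> row 0" if "b \<in> B" for b using that B(3) span_base by blast
  have a: "a1 (u ! i) \<in> span B" "a2 (u ! i) \<in> span B"
    using au_row[OF i] B(3) by simp_all
  have "trace_on smul B (left_mult u) = trace_on smul B (\<lambda>x. sign s \<cdot>
      (coord (left_mult (u[i := x])) 4 \<cdot> a1 (u ! i) + coord (left_mult (u[i := x])) 5 \<cdot> a2 (u ! i)))"
    by (rule trace_on_cong[OF B(1,2)]) (rule L[OF in_B])
  also have "\<dots> = sign s * (trace_on smul B (\<lambda>x. coord (left_mult (u[i := x])) 4 \<cdot> a1 (u ! i)) +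
      trace_on smul B (\<lambda>x. coord (left_mult (u[i := x])) 5 \<cdot> a2 (u ! i)))"
    by (subst trace_on_scale[OF B(1,2)], simp add: a span_add span_scale,
        subst trace_on_add[OF B(1,2)]) (simp_all add: a span_scale)
  also have "trace_on smul B (\<lambda>x. coord (left_mult (u[i := x])) 4 \<cdot> a1 (u ! i)) =
      coord (left_mult (u[i := a1 (u ! i)])) 4"
    by (rule trace_on_rank_one[OF B(1,2) _ _ a(1)]) (simp_all add: update_coord_linear[OF i])
  also have "trace_on smul B (\<lambda>x. coord (left_mult (u[i := x])) 5 \<cdot> a2 (u ! i)) =
      coord (left_mult (u[i := a2 (u ! i)])) 5"
    by (rule trace_on_rank_one[OF B(1,2) _ _ a(2)]) (simp_all add: update_coord_linear[OF i])
  finally show ?thesis by (simp only: odd_trace_def s)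
qed

text \<open>\<open>L(u)\<close> is even, so the supercommutator is the plain one; on the right,
  \<open>D\<close> passes \<open>i\<close> entries of parity \<pi> + 1.\<close>

lemma commutator_odd_left_mult:
  assumes D: "D \<in> inder_part 1"
  shows "D (left_mult u w) - left_mult u (D w) =
    (\<Sum>i<r - 1. sign (of_nat i * (\<pi> + 1)) \<cdot> left_mult (u[i := D (u ! i)]) w)"
proof -
  have "D (left_mult u w) - sgn_act (1 * sum_list (replicate (r - 1) (\<pi> + 1))) (left_mult u (D w)) =
      (\<Sum>i<r - 1. sgn_act (1 * sum_list (take i (replicate (r - 1) (\<pi> + 1)))) (left_mult (u[i := D (u ! i)]) w))"
    by (rule commutator_left_mult[OF D tuple_length(1)[OF u] u_homog])
  also have "\<dots> = (\<Sum>i<r - 1. sign (of_nat i * (\<pi> + 1)) \<cdot> left_mult (u[i := D (u ! i)]) w)"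
    by (rule sum.cong)
      (simp_all only: lessThan_iff take_replicate min.absorb1 less_imp_le sum_list_replicate mult_1 sgn_act_sign)
  finally show ?thesis by (simp only: sum_list_replicate mult_1 parity_zero sgn_act_0)
qed

text \<open>Both sides are the trace of \<open>D \<mapsto> [D, L(u)]\<close> on the span of \<open>a1\<close> and \<open>a2\<close>.\<close>

lemma sum_odd_trace: "(\<Sum>i<r - 1. sign (of_nat i * (\<pi> + 1)) * odd_trace i) = - 2 * coord (left_mult u) 3"
proof -
  define c where "c = coord (left_mult u)"
  have L: "left_mult u x = c 0 \<cdot> e x + c 1 \<cdot> f x + c 2 \<cdot> h x + c 3 \<cdot> z x" for x
    unfolding c_def by (rule left_mult_weight_0[OF u weight_ns])
  \<comment> \<open>For \<open>D\<close> one of \<open>a1\<close> and \<open>a2\<close>, the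
    derivation rule makes \<open>X D 4\<close> and \<open>X D 5\<close> the coordinates of the
    commutator of \<open>D\<close> with \<open>L(u)\<close>.\<close>
  define X where "X D j = (\<Sum>i<r - 1. sign (of_nat i * (\<pi> + 1)) * coord (left_mult (u[i := D (u ! i)])) j)" for D j
  have X: "D (left_mult u w) - left_mult u (D w) = X D 4 \<cdot> a1 w + X D 5 \<cdot> a2 w"
    if D: "D \<in> inder_part 1" and row: "\<And>i. i < r - 1 \<Longrightarrow> D (u ! i) \<in> row 0" for D w
    unfolding commutator_odd_left_mult[OF D] X_def scale_sum_left sum.distrib[symmetric]
    by (rule sum.cong) (simp_all add: left_mult_update_row_0 row scale_right_distrib)
  \<comment> \<open>Directly, \<open>[a1, h] = a1\<close>, \<open>[a1, z] = - a1\<close> and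
    \<open>[a1, e] = a2\<close>; the coefficients of \<open>a1\<close> are compared.\<close>
  have "c 2 - c 3 - X a1 4 = 0"
  proof -
    have "comb (\<lambda>j. if j = 4 then c 2 - c 3 - X a1 4 else if j = 5 then c 0 - X a1 5 else 0) w = 0" for w
      using X[OF odd_ops(1) au_row(1), of w]
      unfolding L
      by (simp add: comb_def a1.add a1.scale a_rels z_rels algebra_simps)
    from comb_indep[OF this, of 4] show ?thesis by simp
  qed
  \<comment> \<open>Here \<open>[a2, h] = - a2\<close> and \<open>[a2, z] = - a2\<close>, so in the
    trace the coefficient of \<open>h\<close> cancels and that of \<open>z\<close> doubles.\<close>
  moreover have "- c 2 - c 3 - X a2 5 = 0"
  proof -
    have "comb (\<lambda>j. if j = 5 then - c 2 - c 3 - X a2 5 else if j = 4 then c 1 - X a2 4 else 0) w = 0" for w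
      using X[OF odd_ops(2) au_row(2), of w]
      unfolding L
      by (simp add: comb_def a2.add a2.scale a_rels z_rels algebra_simps)
    from comb_indep[OF this, of 5] show ?thesis by simp
  qed
  moreover have "X a1 4 + X a2 5 = - 2 * c 3 - ((c 2 - c 3 - X a1 4) + (- c 2 - c 3 - X a2 5))"
    by simp
  ultimately have "X a1 4 + X a2 5 = - 2 * c 3" by simp
  moreover have "X a1 4 + X a2 5 = (\<Sum>i<r - 1. sign (of_nat i * (\<pi> + 1)) * odd_trace i)"
    by (simp add: X_def odd_trace_def sum.distrib distrib_left)
  ultimately show ?thesis by (simp add: c_def)
qed

text \<open>\<open>z\<close> is the identity on row 0 because \<open>p = 1\<close>, and the sl(2)
  part of \<open>L(u)\<close> has trace 0.\<close>

lemma trace_eq_card: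
  assumes B: "finite B" "independent B" "span B = row 0"
  shows "trace_on smul B (left_mult u) = coord (left_mult u) 3 * of_nat (card B)"
proof -
  let ?c = "coord (left_mult u)"
  have in_B: "b \<in> row 0" if "b \<in> B" for b using that B(3) span_base by blast
  note rows = even_row[OF in_B, folded B(3)]
  have zb: "z b = b" if "b \<in> B" for b
    using row_z[OF in_B[OF that]] concentrated(1)[OF u \<zeta>] by simp
  have "trace_on smul B (left_mult u) =
      trace_on smul B (\<lambda>x. ((?c 0 \<cdot> e x + ?c 1 \<cdot> f x) + ?c 2 \<cdot> h x) + ?c 3 \<cdot> x)"
    by (rule trace_on_cong[OF B(1,2)]) (simp add: left_mult_weight_0[OF u weight_ns] zb)
  also have "\<dots> = ((?c 0 * trace_on smul B e + ?c 1 * trace_on smul B f) + ?c 2 * trace_on smul B h) +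
      ?c 3 * trace_on smul B (\<lambda>x. x)"
    by (simp add: trace_on_add[OF B(1,2)] trace_on_scale[OF B(1,2)] rows span_add span_scale span_base)
  finally show ?thesis
    by (simp add: trace_sl2[OF B] trace_on_id[OF B(1,2)])
qed

text \<open>After division by \<zeta> the trace formulas give
  \<open>(r - 1) * card B = - 2 * sign \<pi>\<close>. An even \<open>t\<close> would make a positive
  number 0, so \<open>t\<close> is odd, and \<open>r \<ge> 3\<close> leaves only the factorization
  \<open>2 * 1\<close>.\<close>

lemma dimensions: "r = 3" "\<pi> = 1" "x \<in> row 0 \<Longrightarrow> \<exists>c. x = c \<cdot> t"
proof -
  obtain B where B: "B \<subseteq> row 0" "independent B" "row 0 \<subseteq> span B"
    using maximal_independent_subset[of "row 0"] by blast
  have fin: "finite B" by (rule finiteI_independent[OF B(2)])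
  have span: "span B = row 0"
    using B span_minimal[OF B(1) row_subspace] by blast
  note tr = trace_eq_card[OF fin B(2) span]
  let ?\<zeta> = "coord (left_mult u) 3"
  have "- 2 * ?\<zeta> = (\<Sum>i<r - 1. sign (of_nat i * (\<pi> + 1)) * odd_trace i)" by (rule sum_odd_trace[symmetric])
  also have "\<dots> = (\<Sum>i<r - 1. sign \<pi> * (?\<zeta> * of_nat (card B)))"
  proof (rule sum.cong)
    fix i assume "i \<in> {..<r - 1}"
    then have i: "i < r - 1" by simp
    have "?\<zeta> * of_nat (card B) = sign (of_nat i * (\<pi> + 1)) * sign \<pi> * odd_trace i"
      using trace_eq_odd_trace[OF fin B(2) span i] unfolding tr sign_add .
    then have "sign \<pi> * (?\<zeta> * of_nat (card B)) =
        (sign \<pi> * sign \<pi>) * (sign (of_nat i * (\<pi> + 1)) * odd_trace i)"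
      by (simp only: mult_ac)
    then show "sign (of_nat i * (\<pi> + 1)) * odd_trace i = sign \<pi> * (?\<zeta> * of_nat (card B))"
      by (simp only: sign_square mult_1)
  qed simp
  also have "\<dots> = ?\<zeta> * (sign \<pi> * of_nat ((r - 1) * card B))"
    by (simp only: sum_constant card_lessThan of_nat_mult mult_ac)
  finally have "- 2 * ?\<zeta> = ?\<zeta> * (sign \<pi> * of_nat ((r - 1) * card B))" .
  moreover have "?\<zeta> * (y + 2) = ?\<zeta> * y - (- 2 * ?\<zeta>)" for y
    by (simp add: distrib_left)
  ultimately have "?\<zeta> * (sign \<pi> * of_nat ((r - 1) * card B) + 2) = 0"
    by (simp only: diff_self)
  then have eq: "sign \<pi> * of_nat ((r - 1) * card B) + 2 = 0"
    using \<zeta> by simp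
  have \<pi>: "\<pi> \<noteq> 0"
  proof
    assume "\<pi> = 0"
    then have "of_nat ((r - 1) * card B + 2) = (0 :: 'a)"
      using eq by (simp only: sign_def simp_thms if_True mult_1 of_nat_add of_nat_numeral)
    then show False by (simp only: of_nat_eq_0_iff)
  qed
  then show "\<pi> = 1" by simp
  have "of_nat ((r - 1) * card B) = (of_nat 2 :: 'a)"
    using eq unfolding sign_def if_not_P[OF \<pi>] by (simp del: of_nat_mult)
  then have *: "(r - 1) * card B = 2" by (simp only: of_nat_eq_iff)
  have card: "card B = 1"
  proof -
    have "card B \<noteq> 0" using * by (metis mult_zero_right zero_neq_numeral)
    moreover have "2 * card B \<le> (r - 1) * card B"
      using arity_ge_3 by (intro mult_le_mono1) simp
    ultimately show ?thesis unfolding * by simp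
  qed
  then show "r = 3" using * by simp
  obtain b where b: "B = {b}" using card by (rule card_1_singletonE)
  obtain c where c: "t = c \<cdot> b" using t_row span by (auto simp: b span_singleton)
  then have "c \<noteq> 0" using t(2) by auto
  assume "x \<in> row 0"
  then obtain d where "x = d \<cdot> b" using span by (auto simp: b span_singleton)
  then have "x = (d / c) \<cdot> t" using c \<open>c \<noteq> 0\<close> by simp
  then show "\<exists>c. x = c \<cdot> t" ..
qed

end

section \<open>The four-dimensional case\<close>

text \<open>Exchanging the two equal even entries changes the sign, so twice the value is 0.\<close>

lemma left_mult_even_twice:
  assumes r: "r = 3" and x: "x \<in> V 0"
  shows "left_mult [x, x] w = 0"
proof -
  have hom: "left_mult [x, x] w = 0" if "w \<in> V \<gamma>" for w \<gamma>
  proof -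
    have "br ([] @ [x, x] @ [w]) = - sgn_act (0 * 0) (br ([] @ [x, x] @ [w]))"
      using r x that by (intro br_anticomm[where \<alpha>s = "[]" and \<beta>s = "[\<gamma>]"]) auto
    then have "2 \<cdot> left_mult [x, x] w = 0"
      unfolding left_mult_def one_add_one[symmetric] scale_left_distrib by (simp add: eq_neg_iff_add_eq_0)
    then show ?thesis by simp
  qed
  interpret L: Vector_Spaces.linear smul smul "left_mult [x, x]"
    using r by (intro left_mult_linear) simp
  obtain a b where "a \<in> V 0" "b \<in> V 1" "w = a + b" using grading_sum by blast
  then show ?thesis using hom by (simp add: L.add)
qed

text \<open>Row 0 is the line of \<open>t\<close>, on which sl(2) acts by zero, so
  \<open>t, b1 t, b2 t, b1 (b2 t)\<close> span the module. A pair \<open>u\<close> of these vectors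
  with nonzero \<open>h\<close>-coordinate has an \<open>L(u)\<close> that commutes with
  \<open>e\<close>, against \<open>[e, h] = - 2 e\<close>.\<close>

lemma top_inconsistent: False
proof -
  obtain u0 ns0 where u0: "tuple u0 ns0" "coord (left_mult u0) 3 \<noteq> 0"
    using ex_tuple_coord[of 3] by auto
  note r = dimensions(1)[OF u0] and \<pi> = dimensions(2)[OF u0] and row0 = dimensions(3)[OF u0]
    and p = concentrated(1)[OF u0]
  have zt: "z t = t" using t(3) p by simp
  obtain c d where cd: "e t = c \<cdot> t" "h t = d \<cdot> t"
    using row0 even_row(1,3)[OF t_row] by metis
  \<comment> \<open>\<open>e t\<close> and \<open>h t\<close> are multiples of \<open>t\<close>, so
    \<open>[h, e]\<close> kills \<open>t\<close>, and \<open>2 e t = 0\<close>.\<close>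
  have et: "e t = 0"
    using sl2_rels(1)[of t] by (simp add: cd e.scale h.scale mult.commute)
  obtain c' where c': "f t = c' \<cdot> t"
    using row0 even_row(2)[OF t_row] by metis
  have ft: "f t = 0"
    using sl2_rels(2)[of t] by (simp add: cd(2) c' f.scale h.scale mult.commute)
  have ht: "h t = 0"
    using sl2_rels(3)[of t] by (simp add: et ft e.zero f.zero)
  note at = a_row_0[OF t_row]
  define S where "S = {t, b1 t, b2 t, b1 (b2 t)}"
  have inS: "t \<in> span S" "b1 t \<in> span S" "b2 t \<in> span S" "b1 (b2 t) \<in> span S"
    by (auto simp: S_def intro: span_base)
  note vals = zt et ft ht at
  have "span S = UNIV"
  proof (rule span_eq_UNIV)
    show "t \<in> S" by (simp add: S_def)
    show "t \<noteq> 0" by (rule t)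
    have "\<forall>x\<in>S. \<exists>n. x \<in> row n"
      using t_row b_row[OF t_row] b_row[OF b_row(2)[OF t_row]] unfolding S_def by blast
    then show "\<exists>\<alpha>. x \<in> V \<alpha>" if "x \<in> S" for x
      using that row_V by blast
    fix x assume "x \<in> S"
    then consider "x = t" | "x = b1 t" | "x = b2 t" | "x = b1 (b2 t)"
      unfolding S_def by blast
    then have "e x \<in> span S \<and> f x \<in> span S \<and> h x \<in> span S \<and> z x \<in> span S \<and>
        a1 x \<in> span S \<and> a2 x \<in> span S \<and> b1 x \<in> span S \<and> b2 x \<in> span S"
      by cases (simp_all add: vals b_rels z_rels ab_rels bb_rels ops_linear inS
          span_zero span_neg span_scale span_diff span_add)
    then show "e x \<in> span S" "f x \<in> span S" "h x \<in> span S" "z x \<in> span S"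
        "a1 x \<in> span S" "a2 x \<in> span S" "b1 x \<in> span S" "b2 x \<in> span S"
      by blast+
  qed
  from ex_left_mult_coord[OF this, of 2] obtain u
    where u: "length u = 2" "set u \<subseteq> S" "coord (left_mult u) 2 \<noteq> 0"
    using r by auto
  then obtain x y where xy: "u = [x, y]"
    by (metis One_nat_def Suc_1 length_0_conv length_Suc_conv)
  have S_rows: "(v = t \<and> v \<in> row 0) \<or> (v = b1 t \<and> v \<in> row 1) \<or> (v = b2 t \<and> v \<in> row 1) \<or>
      (v = b1 (b2 t) \<and> v \<in> row 2)" if "v \<in> S" for v
    using that t_row b_row[OF t_row] b_row(1)[OF b_row(2)[OF t_row]]
    unfolding S_def by (auto simp: numeral_2_eq_2)
  \<comment> \<open>A nonzero \<open>h\<close>-coordinate forces weight 0; with \<open>r = 3\<close>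
    and \<open>p = 1\<close> the rows of the two entries add up to 2.\<close>
  have weight_0: "n + m = 2" "weight [n, m] = 0" "tuple u [n, m]" if "x \<in> row n" "y \<in> row m" for n m
  proof -
    show tup: "tuple u [n, m]" unfolding tuple_def xy using that r by simp
    show w0: "weight [n, m] = 0"
      using weight_coord[OF tup _ u(3)] by (simp add: ad_weight_def)
    then have "of_nat (n + m) = (of_nat 2 :: 'a)"
      unfolding weight_def by (simp add: r p)
    then show "n + m = 2" by (simp only: of_nat_eq_iff)
  qed
  obtain n m where nm: "x \<in> row n" "y \<in> row m"
    using S_rows[of x] S_rows[of y] u(2) unfolding xy by auto
  have even: "b1 t \<in> V 0" "b2 t \<in> V 0"
    using row_V[OF b_row(1)[OF t_row]] row_V[OF b_row(2)[OF t_row]] \<pi> by simp_all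
  have l: "length u = r - 1" using u(1) r by simp
  \<comment> \<open>\<open>e\<close> kills all the vectors of \<open>S\<close> except
    \<open>b2 t\<close>, which it sends to \<open>b1 t\<close>. Apart from terms with a zero entry
    only the pair \<open>b1 t, b1 t\<close> arises, and its left multiplication is 0. The pair
    \<open>b2 t, b2 t\<close> is excluded for \<open>u\<close> itself in the same way.\<close>
  have "(\<Sum>i<2. left_mult (u[i := e (u ! i)]) w) = 0" for w
  proof -
    have sum2: "(\<Sum>i<2. g i) = g 0 + g (1::nat)" for g :: "nat \<Rightarrow> 'b"
      by (simp add: numeral_2_eq_2)
    have zero: "left_mult [0, v] w = 0" "left_mult [v, 0] w = 0" for v
      using left_mult_update_zero[of "[v, v]" 0 w] left_mult_update_zero[of "[v, v]" 1 w] r by simp_all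
    have e_vals: "e (b1 t) = 0" "e (b2 t) = b1 t" "e (b1 (b2 t)) = 0"
      by (simp_all add: b_rels et b1.zero b2.zero b1.add bb_rels)
    have "left_mult [x, y] \<noteq> 0" using u(3) coord_zero[of 2] unfolding xy by auto
    then have "\<not> (x = b2 t \<and> y = b2 t)"
      using left_mult_even_twice[OF r even(2)] by auto
    then show ?thesis
      using S_rows[of x] S_rows[of y] u(2) weight_0(1)
      unfolding sum2 xy
      by (auto simp: zero e_vals et left_mult_even_twice[OF r even(1)]; fastforce)
  qed
  then have comm: "e (left_mult u w) - left_mult u (e w) = 0" for w
    using commutator_left_mult[OF even_ops(1) l tuple_homog[OF weight_0(3)[OF nm]], of w] r by simp
  define k where "k = coord (left_mult u)"
  have L: "left_mult u w = k 0 \<cdot> e w + k 1 \<cdot> f w + k 2 \<cdot> h w + k 3 \<cdot> z w" for w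
    unfolding k_def by (rule left_mult_weight_0[OF weight_0(3,2)[OF nm]])
  \<comment> \<open>These are the coordinates of \<open>[e, L(u)]\<close>, from
    \<open>[e, h] = - 2 e\<close> and \<open>[e, f] = h\<close>.\<close>
  have "comb (\<lambda>j. if j = 0 then - 2 * k 2 else if j = 2 then k 1 else 0) w = 0" for w
    using comm[of w] unfolding L
    by (simp add: comb_def e.add e.scale sl2_rels z_rels algebra_simps)
  from comb_indep[OF this, of 0] have "k 2 = 0" by simp
  then show False using u(3) by (simp add: k_def)
qed

end

lemma (in filippov_A_1_0) inconsistent: False
proof -
  obtain p \<pi> t where "t \<in> V \<pi>" "t \<noteq> 0" "z t = p \<cdot> t" "\<forall>x. z x = (p + 1) \<cdot> x \<longrightarrow> x = 0"
    using ex_top_homogeneous by blast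
  then interpret filippov_A_1_0_top smul r V br Bs e f h z a1 a2 b1 b2 p \<pi> t
    by unfold_locales simp_all
  show False by (rule top_inconsistent)
qed

section \<open>Generators of sl(2,1)\<close>

definition matrix_unit :: "'n \<Rightarrow> 'm \<Rightarrow> 'a::{zero,one}^'m^'n" where
  "matrix_unit i j = (\<chi> a b. if a = i \<and> b = j then 1 else 0)"

text \<open>In the two-element type the numeral 2 denotes 0, which differs from the index 1.\<close>

lemma one_neq_two_type_2: "(1::2) \<noteq> 2" "(2::2) \<noteq> 1"
  by simp_all

lemma all_sum_2_1: "(\<forall>i::2 + 1. P i) \<longleftrightarrow> P (Inl 1) \<and> P (Inl 2) \<and> P (Inr 1)"
  by (metis exhaust_2 num1_eq1 sum.exhaust)

lemma sum_UNIV_2_1: "(\<Sum>i\<in>(UNIV::(2 + 1) set). g i) = g (Inl 1) + g (Inl 2) + g (Inr 1)"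
proof -
  have *: "(UNIV::(2 + 1) set) = {Inl 1, Inl 2, Inr 1}"
    using all_sum_2_1[of "\<lambda>i. i \<in> {Inl 1, Inl 2, Inr 1}"] by blast
  show ?thesis unfolding * by (simp add: add.assoc)
qed

lemma gl_part_inter: "gl_part 0 \<inter> gl_part 1 = ({0} :: ('a::field^('m::finite + 'n::finite)^('m + 'n)) set)"
proof -
  have "M = 0" if "M \<in> gl_part 0 \<inter> gl_part 1" for M :: "'a^('m + 'n)^('m + 'n)"
  proof -
    have "M $ i $ j = 0" for i j
      using that by (cases i; cases j)
        (auto simp: gl_part_def block_A_def block_B_def block_C_def block_D_def vec_eq_iff)
    then show ?thesis by (simp add: vec_eq_iff)
  qed
  moreover have "0 \<in> gl_part \<alpha>" for \<alpha>
    by (simp add: gl_part_def block_A_def block_B_def block_C_def block_D_def vec_eq_iff)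
  ultimately show ?thesis by blast
qed

lemma gl_part_diff: "u \<in> gl_part \<gamma> \<Longrightarrow> v \<in> gl_part \<gamma> \<Longrightarrow> u - v \<in> gl_part \<gamma>"
  by (simp add: gl_part_def block_A_def block_B_def block_C_def block_D_def vec_eq_iff split: if_splits)

lemma supercomm_gl:
  assumes "X \<in> gl_part \<alpha>" "Y \<in> gl_part \<beta>"
  shows "supercomm gl_part (**) X Y = X ** Y - sgn_act (\<alpha> * \<beta>) (Y ** X)"
  by (rule supercomm_homogeneous[OF gl_part_inter gl_part_diff _ _ assms])
    (simp_all add: matrix_matrix_mult_def vec_eq_iff)

section \<open>Transport of the relations along the isomorphism\<close>

locale filippov_A_1_0_iso =
  filippov_superalgebra smul r V br + finite_dimensional_vector_space smul Bs
  for smul :: "'k::{alg_closed_field,field_char_0} \<Rightarrow> 'v::ab_group_add \<Rightarrow> 'v" (infixr \<open>\<cdot>\<close> 75)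
    and r V br Bs +
  fixes \<phi> :: "('v \<Rightarrow> 'v) \<Rightarrow> 'k^(2 + 1)^(2 + 1)"
  assumes arity_ge_3: "3 \<le> r" and simple: is_simple
    and bij: "bij_betw \<phi> (lcarrier Inder) (lcarrier A_1_0)"
    and add: "\<And>x y. x \<in> lcarrier Inder \<Longrightarrow> y \<in> lcarrier Inder \<Longrightarrow> \<phi> (x + y) = \<phi> x + \<phi> y"
    and scale: "\<And>c x. x \<in> lcarrier Inder \<Longrightarrow> \<phi> (lscale Inder c x) = lscale A_1_0 c (\<phi> x)"
    and part: "\<And>\<alpha>. \<phi> ` lpart Inder \<alpha> = lpart A_1_0 \<alpha>"
    and bracket: "\<And>x y. x \<in> lcarrier Inder \<Longrightarrow> y \<in> lcarrier Inder \<Longrightarrow>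
      \<phi> (lbracket Inder x y) = lbracket A_1_0 (\<phi> x) (\<phi> y)"
begin

interpretation op: vector_space "end_scale smul"
  by (rule vector_space_end_scale) (rule vector_space_axioms)

lemma Inder_simps: "lcarrier Inder = inder" "lpart Inder \<alpha> = inder_part \<alpha>" "lscale Inder = end_scale smul"
  "lbracket Inder = supercomm (end_part smul V) (\<circ>)"
  by (simp_all add: Inder_def inder_part_eq Let_def)

lemma A_1_0_simps:
  "lcarrier A_1_0 = {M :: 'k^(2 + 1)^(2 + 1). M $ Inl 1 $ Inl 1 + M $ Inl 2 $ Inl 2 = M $ Inr 1 $ Inr 1}"
  "lpart A_1_0 \<alpha> = lcarrier A_1_0 \<inter> (gl_part \<alpha> :: ('k^(2 + 1)^(2 + 1)) set)"
  "lscale A_1_0 c (M :: 'k^(2 + 1)^(2 + 1)) = (\<chi> i j. c * M $ i $ j)"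
  "lbracket A_1_0 = (supercomm gl_part (**) :: 'k^(2 + 1)^(2 + 1) \<Rightarrow> _)"
  by (simp_all add: A_1_0_def sl_def Let_def trace_def block_A_def block_D_def sum_2 sum_1)

lemmas phi_add = add[unfolded Inder_simps]
lemmas phi_scale = scale[unfolded Inder_simps A_1_0_simps]

lemma phi_inj: "D \<in> inder \<Longrightarrow> D' \<in> inder \<Longrightarrow> \<phi> D = \<phi> D' \<Longrightarrow> D = D'"
  using bij unfolding bij_betw_def Inder_simps inj_on_def by blast

lemma phi_zero: "\<phi> 0 = 0"
  using phi_add[of 0 0] op.span_zero by simp

text \<open>Both sides are inner derivations, so the injective \<phi> reflects the equality of their
  matrices.\<close>

lemma phi_bracket:
  assumes D: "D \<in> inder_part \<alpha>" "D' \<in> inder_part \<beta>" and R: "R \<in> inder"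
    and eq: "\<phi> D ** \<phi> D' - sgn_act (\<alpha> * \<beta>) (\<phi> D' ** \<phi> D) = \<phi> R"
  shows "D (D' x) - sgn_act (\<alpha> * \<beta>) (D' (D x)) = R x"
proof -
  have inder: "D \<in> inder" "D' \<in> inder"
    using D inder_part_subset by blast+
  have "\<phi> D \<in> lpart A_1_0 \<alpha>" "\<phi> D' \<in> lpart A_1_0 \<beta>"
    using D part Inder_simps(2) by blast+
  then have gl: "\<phi> D \<in> gl_part \<alpha>" "\<phi> D' \<in> gl_part \<beta>"
    by (simp_all add: A_1_0_simps(2))
  have "\<phi> (lbracket Inder D D') = \<phi> R"
    using bracket[of D D'] inder eq by (simp only: Inder_simps A_1_0_simps(4) supercomm_gl[OF gl])
  moreover have "lbracket Inder D D' = (\<lambda>w. D (D' w) - sgn_act (\<alpha> * \<beta>) (D' (D w)))"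
    using supercomm_inder_part[OF D] by (simp only: Inder_simps)
  moreover from this have "lbracket Inder D D' \<in> inder"
    using inder_part_commutator[OF D] inder_part_subset by (metis IntD1 subsetD)
  ultimately show ?thesis using phi_inj[OF _ R] by metis
qed

definition preimage :: "'k^(2 + 1)^(2 + 1) \<Rightarrow> 'v \<Rightarrow> 'v" where
  "preimage M = inv_into inder \<phi> M"

lemma preimage:
  assumes "M \<in> gl_part \<alpha>" "M $ Inl 1 $ Inl 1 + M $ Inl 2 $ Inl 2 = M $ Inr 1 $ Inr 1"
  shows "\<phi> (preimage M) = M" "preimage M \<in> inder_part \<alpha>"
proof -
  have "M \<in> \<phi> ` inder_part \<alpha>"
    using part[of \<alpha>] assms by (simp only: Inder_simps A_1_0_simps) blast
  then obtain D where D: "D \<in> inder_part \<alpha>" "\<phi> D = M" by blast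
  then have "D \<in> inder" using inder_part_subset by blast
  then have "preimage M = D"
    unfolding preimage_def D(2)[symmetric] using bij
    by (intro inv_into_f_f) (simp_all only: bij_betw_def Inder_simps)
  then show "\<phi> (preimage M) = M" "preimage M \<in> inder_part \<alpha>" using D by simp_all
qed

abbreviation "E \<equiv> (matrix_unit :: 2 + 1 \<Rightarrow> 2 + 1 \<Rightarrow> 'k^(2 + 1)^(2 + 1))"

definition "e = preimage (E (Inl 1) (Inl 2))"
definition "f = preimage (E (Inl 2) (Inl 1))"
definition "h = preimage (E (Inl 1) (Inl 1) - E (Inl 2) (Inl 2))"
text \<open>The matrix \<open>diag(1,1,2)\<close>; its entry 2 is written as a sum of two matrix
  units, so that only matrix addition occurs.\<close>

definition "z = preimage (E (Inl 1) (Inl 1) + E (Inl 2) (Inl 2) + E (Inr 1) (Inr 1) + E (Inr 1) (Inr 1))"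
definition "a1 = preimage (E (Inr 1) (Inl 1))"
definition "a2 = preimage (E (Inr 1) (Inl 2))"
definition "b1 = preimage (E (Inl 1) (Inr 1))"
definition "b2 = preimage (E (Inl 2) (Inr 1))"

lemmas gl_part_simps = gl_part_def block_A_def block_B_def block_C_def block_D_def vec_eq_iff
  matrix_unit_def one_neq_two_type_2

lemma phi_even_ops:
  "\<phi> e = E (Inl 1) (Inl 2)" "\<phi> f = E (Inl 2) (Inl 1)" "\<phi> h = E (Inl 1) (Inl 1) - E (Inl 2) (Inl 2)"
  "\<phi> z = E (Inl 1) (Inl 1) + E (Inl 2) (Inl 2) + E (Inr 1) (Inr 1) + E (Inr 1) (Inr 1)"
  unfolding e_def f_def h_def z_def
  by (rule preimage(1)[where \<alpha> = 0], simp add: gl_part_simps, simp add: gl_part_simps)+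

lemma phi_odd_ops:
  "\<phi> a1 = E (Inr 1) (Inl 1)" "\<phi> a2 = E (Inr 1) (Inl 2)" "\<phi> b1 = E (Inl 1) (Inr 1)" "\<phi> b2 = E (Inl 2) (Inr 1)"
  unfolding a1_def a2_def b1_def b2_def
  by (rule preimage(1)[where \<alpha> = 1], simp add: gl_part_simps, simp add: gl_part_simps)+

lemma ops_part:
  "e \<in> inder_part 0" "f \<in> inder_part 0" "h \<in> inder_part 0" "z \<in> inder_part 0"
  "a1 \<in> inder_part 1" "a2 \<in> inder_part 1" "b1 \<in> inder_part 1" "b2 \<in> inder_part 1"
  unfolding e_def f_def h_def z_def a1_def a2_def b1_def b2_def
  by (rule preimage(2), simp add: gl_part_simps, simp add: gl_part_simps)+

lemmas inder_closed = op.span_add op.span_scale op.span_zero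

lemma ops_in_inder:
  "e \<in> inder" "f \<in> inder" "h \<in> inder" "z \<in> inder" "a1 \<in> inder" "a2 \<in> inder" "b1 \<in> inder" "b2 \<in> inder"
  by (rule IntD1[OF subsetD[OF inder_part_subset]], rule ops_part)+

lemmas phi_simps = phi_even_ops phi_odd_ops phi_add phi_scale phi_zero ops_in_inder inder_closed

lemmas matrix_simps = vec_eq_iff all_sum_2_1 matrix_matrix_mult_def sum_UNIV_2_1 matrix_unit_def
  one_neq_two_type_2

text \<open>Instances of \<open>phi_bracket\<close>. The sign exponents are kept as products of
  parities, and the right sides are built from sums and multiples, on which \<phi> is known; matrix
  computations remain.\<close>

lemma brackets:
  shows
    "h (e x) - sgn_act (0 * 0) (e (h x)) = (end_scale smul 2 e) x"
    "h (f x) - sgn_act (0 * 0) (f (h x)) = (end_scale smul (- 2) f) x"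
    "e (f x) - sgn_act (0 * 0) (f (e x)) = h x"
    "z (e x) - sgn_act (0 * 0) (e (z x)) = 0 x"
    "z (f x) - sgn_act (0 * 0) (f (z x)) = 0 x"
    "z (h x) - sgn_act (0 * 0) (h (z x)) = 0 x"
    "z (a1 x) - sgn_act (0 * 1) (a1 (z x)) = a1 x"
    "z (a2 x) - sgn_act (0 * 1) (a2 (z x)) = a2 x"
    "z (b1 x) - sgn_act (0 * 1) (b1 (z x)) = (end_scale smul (- 1) b1) x"
    "z (b2 x) - sgn_act (0 * 1) (b2 (z x)) = (end_scale smul (- 1) b2) x"
    "e (a1 x) - sgn_act (0 * 1) (a1 (e x)) = (end_scale smul (- 1) a2) x"
    "e (a2 x) - sgn_act (0 * 1) (a2 (e x)) = 0 x"
    "f (a1 x) - sgn_act (0 * 1) (a1 (f x)) = 0 x"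
    "f (a2 x) - sgn_act (0 * 1) (a2 (f x)) = (end_scale smul (- 1) a1) x"
    "h (a1 x) - sgn_act (0 * 1) (a1 (h x)) = (end_scale smul (- 1) a1) x"
    "h (a2 x) - sgn_act (0 * 1) (a2 (h x)) = a2 x"
    "e (b1 x) - sgn_act (0 * 1) (b1 (e x)) = 0 x"
    "e (b2 x) - sgn_act (0 * 1) (b2 (e x)) = b1 x"
    "f (b1 x) - sgn_act (0 * 1) (b1 (f x)) = b2 x"
    "f (b2 x) - sgn_act (0 * 1) (b2 (f x)) = 0 x"
    "h (b1 x) - sgn_act (0 * 1) (b1 (h x)) = b1 x"
    "h (b2 x) - sgn_act (0 * 1) (b2 (h x)) = (end_scale smul (- 1) b2) x"
    "b1 (b1 x) - sgn_act (1 * 1) (b1 (b1 x)) = 0 x"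
    "b2 (b2 x) - sgn_act (1 * 1) (b2 (b2 x)) = 0 x"
    "b2 (b1 x) - sgn_act (1 * 1) (b1 (b2 x)) = 0 x"
    "a1 (b1 x) - sgn_act (1 * 1) (b1 (a1 x)) = (end_scale smul (1 / 2) (z + h)) x"
    "a1 (b2 x) - sgn_act (1 * 1) (b2 (a1 x)) = f x"
    "a2 (b1 x) - sgn_act (1 * 1) (b1 (a2 x)) = e x"
    "a2 (b2 x) - sgn_act (1 * 1) (b2 (a2 x)) = (end_scale smul (1 / 2) (z + end_scale smul (- 1) h)) x"
  by (rule phi_bracket, rule ops_part, rule ops_part, intro inder_closed ops_in_inder,
      simp only: phi_simps, simp add: matrix_simps)+

lemma add_self_eq_0: "y + y = 0 \<Longrightarrow> y = (0 :: 'v)"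
  using scale_left_distrib[of 1 1 y] by simp

section \<open>Coordinates of matrices in sl(2,1)\<close>

text \<open>Coordinates in the images of \<open>e, f, h, z, a1, a2, b1, b2\<close>. The halves come
  from the diagonal \<open>diag(c + d, d - c, 2 d)\<close> of \<open>c h + d z\<close>.\<close>

definition coeffs :: "'k^(2 + 1)^(2 + 1) \<Rightarrow> nat \<Rightarrow> 'k" where
  "coeffs M j = [M $ Inl 1 $ Inl 2, M $ Inl 2 $ Inl 1, (M $ Inl 1 $ Inl 1 - M $ Inl 2 $ Inl 2) / 2,
     M $ Inr 1 $ Inr 1 / 2, M $ Inr 1 $ Inl 1, M $ Inr 1 $ Inl 2, M $ Inl 1 $ Inr 1, M $ Inl 2 $ Inr 1] ! j"

definition comb_op :: "(nat \<Rightarrow> 'k) \<Rightarrow> 'v \<Rightarrow> 'v" where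
  "comb_op c = end_scale smul (c 0) e + end_scale smul (c 1) f + end_scale smul (c 2) h +
     end_scale smul (c 3) z + end_scale smul (c 4) a1 + end_scale smul (c 5) a2 +
     end_scale smul (c 6) b1 + end_scale smul (c 7) b2"

lemma comb_op_apply: "comb_op c x = c 0 \<cdot> e x + c 1 \<cdot> f x + c 2 \<cdot> h x + c 3 \<cdot> z x +
    c 4 \<cdot> a1 x + c 5 \<cdot> a2 x + c 6 \<cdot> b1 x + c 7 \<cdot> b2 x"
  by (simp add: comb_op_def end_scale_def)

lemma comb_op_in_inder: "comb_op c \<in> inder"
  unfolding comb_op_def by (intro inder_closed ops_in_inder)

lemma coeffs_phi_comb_op:
  assumes "j < 8"
  shows "coeffs (\<phi> (comb_op c)) j = c j"
proof -
  from assms consider "j = 0" | "j = 1" | "j = 2" | "j = 3" | "j = 4" | "j = 5" | "j = 6" | "j = 7"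
    by linarith
  then show ?thesis
    by cases (simp only: comb_op_def phi_simps, simp add: coeffs_def matrix_simps)+
qed

text \<open>The off-diagonal entries and the last diagonal entry agree by construction, the first
  two diagonal entries by the trace condition.\<close>

lemma comb_op_coeffs_phi:
  assumes D: "D \<in> inder"
  shows "D = comb_op (coeffs (\<phi> D))"
proof (rule phi_inj[OF D comb_op_in_inder])
  have "\<phi> D \<in> lcarrier A_1_0" using bij D by (auto simp: bij_betw_def Inder_simps)
  then have tr: "\<phi> D $ Inr 1 $ Inr 1 = \<phi> D $ Inl 1 $ Inl 1 + \<phi> D $ Inl 2 $ Inl 2"
    by (simp add: A_1_0_simps)
  show "\<phi> D = \<phi> (comb_op (coeffs (\<phi> D)))"
    unfolding comb_op_def
    by (simp only: phi_simps) (simp add: coeffs_def matrix_simps tr field_simps)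
qed

sublocale filippov_A_1_0 smul r V br Bs e f h z a1 a2 b1 b2
proof unfold_locales
  show "3 \<le> r" by (rule arity_ge_3)
  show is_simple by (rule simple)
  fix x
  note b = brackets[of x, unfolded mult_zero_left mult_zero_right mult_1 sgn_act_0 sgn_act_1 end_scale_def
      plus_fun_apply zero_fun_apply]
  show "h (e x) = e (h x) + 2 \<cdot> e x" "h (f x) = f (h x) - 2 \<cdot> f x" "e (f x) = f (e x) + h x"
    using b(1-3) by (simp_all add: diff_eq_eq add.commute)
  show "z (e x) = e (z x)" "z (f x) = f (z x)" "z (h x) = h (z x)"
      "z (a1 x) = a1 (z x) + a1 x" "z (a2 x) = a2 (z x) + a2 x"
      "z (b1 x) = b1 (z x) - b1 x" "z (b2 x) = b2 (z x) - b2 x"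
    using b(4-10) by (simp_all add: diff_eq_eq add.commute)
  show "e (a1 x) = a1 (e x) - a2 x" "e (a2 x) = a2 (e x)"
      "f (a1 x) = a1 (f x)" "f (a2 x) = a2 (f x) - a1 x"
      "h (a1 x) = a1 (h x) - a1 x" "h (a2 x) = a2 (h x) + a2 x"
    using b(11-16) by (simp_all add: diff_eq_eq add.commute)
  show "e (b1 x) = b1 (e x)" "e (b2 x) = b2 (e x) + b1 x"
      "f (b1 x) = b1 (f x) + b2 x" "f (b2 x) = b2 (f x)"
      "h (b1 x) = b1 (h x) + b1 x" "h (b2 x) = b2 (h x) - b2 x"
    using b(17-22) by (simp_all add: diff_eq_eq add.commute)
  \<comment> \<open>The superbracket of an odd operator with itself is twice its square, and 2 is
    invertible.\<close>
  show "b1 (b1 x) = 0" "b2 (b2 x) = 0"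
    by (rule add_self_eq_0, use b(23,24) in simp)+
  show "b2 (b1 x) = - b1 (b2 x)"
    using b(25) by (simp add: eq_neg_iff_add_eq_0)
  show "a1 (b1 x) = (1 / 2) \<cdot> (z x + h x) - b1 (a1 x)" "a1 (b2 x) = f x - b2 (a1 x)"
      "a2 (b1 x) = e x - b1 (a2 x)" "a2 (b2 x) = (1 / 2) \<cdot> (z x - h x) - b2 (a2 x)"
    using b(26-29) by (simp_all add: eq_diff_eq)
next
  fix D assume "D \<in> inder"
  then have "D x = comb_op (coeffs (\<phi> D)) x" for x using comb_op_coeffs_phi by metis
  then show "\<exists>c :: nat \<Rightarrow> 'k. \<forall>x. D x = c 0 \<cdot> e x + c 1 \<cdot> f x + c 2 \<cdot> h x + c 3 \<cdot> z x +
      c 4 \<cdot> a1 x + c 5 \<cdot> a2 x + c 6 \<cdot> b1 x + c 7 \<cdot> b2 x"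
    unfolding comb_op_apply by blast
next
  fix c :: "nat \<Rightarrow> 'k" and j :: nat
  assume "\<And>x. c 0 \<cdot> e x + c 1 \<cdot> f x + c 2 \<cdot> h x + c 3 \<cdot> z x +
      c 4 \<cdot> a1 x + c 5 \<cdot> a2 x + c 6 \<cdot> b1 x + c 7 \<cdot> b2 x = 0" and j: "j < 8"
  then have 0: "comb_op c = 0" by (simp add: fun_eq_iff comb_op_apply)
  have "c j = coeffs (\<phi> 0) j"
    using coeffs_phi_comb_op[OF j, of c] unfolding 0 by simp
  also have "\<dots> = coeffs (\<phi> (comb_op (\<lambda>_. 0))) j"
    by (rule arg_cong[where f = "\<lambda>D. coeffs (\<phi> D) j"]) (simp add: fun_eq_iff comb_op_apply)
  finally show "c j = 0" by (simp only: coeffs_phi_comb_op[OF j])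
qed (rule ops_part)+

end

theorem theorem4p1:
  fixes r :: nat
  assumes "3 \<le> r"
  shows "\<nexists>(smul :: 'k::{alg_closed_field, field_char_0} \<Rightarrow> 'v::ab_group_add \<Rightarrow> 'v) V br.
    filippov_superalgebra smul r V br \<and>
    (\<exists>B. finite_dimensional_vector_space smul B) \<and>
    filippov_superalgebra.is_simple smul r V br \<and>
    filippov_superalgebra.has_type smul r V br (A_1_0 :: ('k, 'k^(2 + 1)^(2 + 1)) lie_super)"
proof clarify
  fix smul :: "'k \<Rightarrow> 'v \<Rightarrow> 'v" and V br B
  assume F: "filippov_superalgebra smul r V br" and B: "finite_dimensional_vector_space smul B"
    and simple: "filippov_superalgebra.is_simple smul r V br"
    and A_1_0: "filippov_superalgebra.has_type smul r V br (A_1_0 :: ('k, 'k^(2 + 1)^(2 + 1)) lie_super)"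
  interpret F: filippov_superalgebra smul r V br by (rule F)
  interpret B: finite_dimensional_vector_space smul B by (rule B)
  from A_1_0 obtain \<phi> where
    "bij_betw \<phi> (lcarrier F.Inder) (lcarrier (A_1_0 :: ('k, 'k^(2 + 1)^(2 + 1)) lie_super)) \<and>
      (\<forall>x\<in>lcarrier F.Inder. \<forall>y\<in>lcarrier F.Inder. \<phi> (x + y) = \<phi> x + \<phi> y) \<and>
      (\<forall>c. \<forall>x\<in>lcarrier F.Inder. \<phi> (lscale F.Inder c x) = lscale A_1_0 c (\<phi> x)) \<and>
      (\<forall>\<alpha>. \<phi> ` lpart F.Inder \<alpha> = lpart A_1_0 \<alpha>) \<and>
      (\<forall>x\<in>lcarrier F.Inder. \<forall>y\<in>lcarrier F.Inder.
        \<phi> (lbracket F.Inder x y) = lbracket A_1_0 (\<phi> x) (\<phi> y))"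
    unfolding F.has_type_def lie_super_isomorphic_def by blast
  \<comment> \<open>The type condition has supplied \<phi>; its locale inherits
    \<open>inconsistent\<close> from the locale of the eight operators.\<close>
  then interpret filippov_A_1_0_iso smul r V br B \<phi>
    using assms simple by unfold_locales simp_all
  show False by (rule inconsistent)
qed

end
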